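(* Let $R$ be an $F$-finite Noetherian ring with $p$-generating set $x=x_1,\dots,x_n$, and let $y=y_1,\dots,y_m\in R$ be a sequence of additional elements. Then there is a (non-canonical) isomorphism $$G(R;x,y)\cong G(R;x)\llbracket t_1,\dots,t_m\rrbracket$$ such that, under it, the surjection $\pi_\infty^{x,y}:G(R;x,y)\twoheadrightarrow R$ corresponds to the surjection $G(R;x)\llbracket t_1,\dots,t_m\rrbracket\twoheadrightarrow R$ given by $\pi_\infty^x$ on $G(R;x)$ and $t_i\mapsto0$.
   Context: Fix a prime $p$; rings are commutative of characteristic $p$. $R^p\subseteq R$ is the image of Frobenius; $R$ is $F$-finite if Frobenius is finite. A finite tuple $x$ in $R$ is a $p$-generating set if $R=R^p[x_1,\dots,x_n]$. $x,y$ denotes the concatenated tuple. Gabber's construction: given an $F$-finite Noetherian ring $R$ with $p$-generating set $x$, put $R_0=R$, $x^{(0)}=x$, and inductively $R_{i}=R_{i-1}[X_1,\dots,X_n]/(X_j^p-x_j^{(i-1)})_{j}$ with $x_j^{(i)}$ the class of $X_j$, and $\phi:R_i\to R_{i-1}$ the surjection with $r\mapsto r^p$ for $r\in R_{i-1}$ and $X_j\mapsto x_j^{(i-1)}$. Then $G(R;x):=\varprojlim_\phi R_i$, and $\pi_\infty^x:G(R;x)\to R_0=R$ is the projection, which is surjective. *)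

theory Defs
  imports "HOL-Algebra.Algebra" "HOL-Algebra.Indexed_Polynomials"
    "HOL-Computational_Algebra.Primes"
begin

section \<open>F-finite rings and p-generating tuples\<close>

definition pth_powers :: "nat \<Rightarrow> ('a, 'b) ring_scheme \<Rightarrow> 'a set" where
  "pth_powers p R = (\<lambda>r. r [^]\<^bsub>R\<^esub> p) ` carrier R"

text \<open>Vanishing of \<open>p\<close> in the ring; for prime \<open>p\<close> and a nonzero ring this is characteristic
  \<open>p\<close>, and the zero ring is allowed (as an \<open>F\<^sub>p\<close>-algebra).\<close>

definition has_char :: "nat \<Rightarrow> ('a, 'b) ring_scheme \<Rightarrow> bool" where
  "has_char p R \<longleftrightarrow> [p] \<cdot>\<^bsub>R\<^esub> \<one>\<^bsub>R\<^esub> = \<zero>\<^bsub>R\<^esub>"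

definition F_finite :: "nat \<Rightarrow> ('a, 'b) ring_scheme \<Rightarrow> bool" where
  "F_finite p R \<longleftrightarrow>
    (\<exists>us. set us \<subseteq> carrier R \<and> ring.Span R (pth_powers p R) us = carrier R)"

definition p_generating :: "nat \<Rightarrow> ('a, 'b) ring_scheme \<Rightarrow> 'a list \<Rightarrow> bool" where
  "p_generating p R xs \<longleftrightarrow>
    set xs \<subseteq> carrier R \<and> generate_ring R (pth_powers p R \<union> set xs) = carrier R"


section \<open>Power series and polynomials in several variables\<close>

text \<open>As in \<^theory>\<open>HOL-Algebra.Indexed_Polynomials\<close>, monomials are multisets of indices and a
  (formal) series is its coefficient function.\<close>

definition series_mult ::
  "('a, 'b) ring_scheme \<Rightarrow> ('c multiset \<Rightarrow> 'a) \<Rightarrow> ('c multiset \<Rightarrow> 'a) \<Rightarrow> 'c multiset \<Rightarrow> 'a" where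
  "series_mult R f g = (\<lambda>M. \<Oplus>\<^bsub>R\<^esub>N\<in>{N. N \<subseteq># M}. f N \<otimes>\<^bsub>R\<^esub> g (M - N))"

definition series_ring :: "('a, 'b) ring_scheme \<Rightarrow> 'c set \<Rightarrow> ('c multiset \<Rightarrow> 'a) ring" where
  "series_ring R I =
    \<lparr>carrier = {f. (\<forall>M. f M \<in> carrier R) \<and> (\<forall>M. \<not> set_mset M \<subseteq> I \<longrightarrow> f M = \<zero>\<^bsub>R\<^esub>)},
     monoid.mult = series_mult R,
     one = ring.indexed_const R \<one>\<^bsub>R\<^esub>,
     ring.zero = ring.indexed_const R \<zero>\<^bsub>R\<^esub>,
     add = ring.indexed_padd R\<rparr>"

definition indexed_poly_ring :: "('a, 'b) ring_scheme \<Rightarrow> 'c set \<Rightarrow> ('c multiset \<Rightarrow> 'a) ring" where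
  "indexed_poly_ring R I = (series_ring R I)\<lparr>carrier := ring.indexed_pset R I (carrier R)\<rparr>"


section \<open>Gabber's construction\<close>

text \<open>The rings of the tower have to live in a single type. An element of a stage above the bottom
  one is a class of polynomials over the previous stage; it is stored as \<open>Step f\<close> for one
  chosen polynomial \<open>f\<close> in that class. The stage itself is the literal quotient ring,
  transported along this injective encoding of its elements.\<close>

datatype 'a tower = Base (base_val: 'a) | Step (step_poly: "nat multiset \<Rightarrow> 'a tower")

definition class_code :: "(nat multiset \<Rightarrow> 'a tower) set \<Rightarrow> 'a tower" where
  "class_code C = Step (SOME f. f \<in> C)"

definition root_ideal :: "nat \<Rightarrow> 'a tower ring \<Rightarrow> 'a tower list \<Rightarrow> (nat multiset \<Rightarrow> 'a tower) set" where
  "root_ideal p S zs =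
    (let P = indexed_poly_ring S {..<length zs} in
     Idl\<^bsub>P\<^esub> {ring.indexed_var S j [^]\<^bsub>P\<^esub> p \<ominus>\<^bsub>P\<^esub> ring.indexed_const S (zs ! j) | j. j < length zs})"

definition adjoin_roots :: "nat \<Rightarrow> 'a tower ring \<Rightarrow> 'a tower list \<Rightarrow> 'a tower ring" where
  "adjoin_roots p S zs =
    image_ring class_code (indexed_poly_ring S {..<length zs} Quot root_ideal p S zs)"

definition adjoined_roots :: "nat \<Rightarrow> 'a tower ring \<Rightarrow> 'a tower list \<Rightarrow> 'a tower list" where
  "adjoined_roots p S zs =
    map (\<lambda>j. class_code (root_ideal p S zs +>\<^bsub>indexed_poly_ring S {..<length zs}\<^esub>
                         ring.indexed_var S j)) [0..<length zs]"

primrec gabber_stage ::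
  "nat \<Rightarrow> ('a, 'b) ring_scheme \<Rightarrow> 'a list \<Rightarrow> nat \<Rightarrow> 'a tower ring \<times> 'a tower list" where
  "gabber_stage p R xs 0 = (image_ring Base R, map Base xs)"
| "gabber_stage p R xs (Suc i) =
    (case gabber_stage p R xs i of (S, zs) \<Rightarrow> (adjoin_roots p S zs, adjoined_roots p S zs))"

definition stage_ring :: "nat \<Rightarrow> ('a, 'b) ring_scheme \<Rightarrow> 'a list \<Rightarrow> nat \<Rightarrow> 'a tower ring" where
  "stage_ring p R xs i = fst (gabber_stage p R xs i)"

definition stage_tuple :: "nat \<Rightarrow> ('a, 'b) ring_scheme \<Rightarrow> 'a list \<Rightarrow> nat \<Rightarrow> 'a tower list" where
  "stage_tuple p R xs i = snd (gabber_stage p R xs i)"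

text \<open>The map from stage \<open>i + 1\<close> to stage \<open>i\<close> raises coefficients to the
  \<open>p\<close>-th power and sends the \<open>j\<close>-th variable to the \<open>j\<close>-th entry of the tuple of
  stage \<open>i\<close>. In characteristic \<open>p\<close> the value does not depend on the polynomial
  representing the class.\<close>

definition stage_map :: "nat \<Rightarrow> ('a, 'b) ring_scheme \<Rightarrow> 'a list \<Rightarrow> nat \<Rightarrow> 'a tower \<Rightarrow> 'a tower" where
  "stage_map p R xs i a =
    (let S = stage_ring p R xs i; zs = stage_tuple p R xs i; f = step_poly a in
     \<Oplus>\<^bsub>S\<^esub>M\<in>{M. f M \<noteq> \<zero>\<^bsub>S\<^esub>}.
       (f M [^]\<^bsub>S\<^esub> p) \<otimes>\<^bsub>S\<^esub> (\<Otimes>\<^bsub>S\<^esub>j\<in>set_mset M. (zs ! j) [^]\<^bsub>S\<^esub> count M j))"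

definition gabber_ring :: "nat \<Rightarrow> ('a, 'b) ring_scheme \<Rightarrow> 'a list \<Rightarrow> (nat \<Rightarrow> 'a tower) ring" where
  "gabber_ring p R xs =
    \<lparr>carrier = {s. \<forall>i. s i \<in> carrier (stage_ring p R xs i) \<and> stage_map p R xs i (s (Suc i)) = s i},
     monoid.mult = (\<lambda>s t i. s i \<otimes>\<^bsub>stage_ring p R xs i\<^esub> t i),
     one = (\<lambda>i. \<one>\<^bsub>stage_ring p R xs i\<^esub>),
     ring.zero = (\<lambda>i. \<zero>\<^bsub>stage_ring p R xs i\<^esub>),
     add = (\<lambda>s t i. s i \<oplus>\<^bsub>stage_ring p R xs i\<^esub> t i)\<rparr>"

text \<open>The projection to stage \<open>0\<close>, whose elements are the \<open>Base r\<close> with \<open>r\<close> in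
  \<open>R\<close>.\<close>

definition gabber_proj :: "(nat \<Rightarrow> 'a tower) \<Rightarrow> 'a" where
  "gabber_proj s = base_val (s 0)"

text \<open>The map given by \<open>gabber_proj\<close> on constants and sending each variable to \<open>0\<close>. A series
  in finitely many variables without constant term lies in the ideal generated by the variables,
  so every ring homomorphism with these values sends a series to the projection of its constant
  coefficient.\<close>

definition series_proj :: "('c multiset \<Rightarrow> nat \<Rightarrow> 'a tower) \<Rightarrow> 'a" where
  "series_proj f = gabber_proj (f {#})"

end

theory Submission
  imports Defs
begin

text \<open>
  Let \<open>A i\<close> and \<open>B i\<close> be the stages of the towers of \<open>xs\<close> and \<open>xs @ ys\<close>. Since \<open>xs\<close>
  \<open>p\<close>-generates \<open>R\<close>, all transition maps of the first tower are surjective, so the \<open>j\<close>-th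
  entry of \<open>ys\<close> lifts to some \<open>\<eta> j\<close> in the limit of the \<open>A i\<close>. In \<open>B i\<close> let \<open>\<tau> i j\<close> be
  the root attached to this entry minus the image of the \<open>i\<close>-th component of \<open>\<eta> j\<close>. The
  transition maps send \<open>\<tau> (i + 1) j\<close> to \<open>\<tau> i j\<close>, and the \<open>p\<close>-th power of \<open>\<tau> (i + 1) j\<close> is the
  image of \<open>\<tau> i j\<close>, while \<open>\<tau> 0 j = 0\<close>. It follows that \<open>B i\<close> is the polynomial ring over
  \<open>A i\<close> in variables corresponding to the \<open>\<tau> i j\<close>, modulo the \<open>p ^ i\<close>-th powers of the variables.
  In the limit these truncated polynomial rings become the power series ring over the limit of
  the \<open>A i\<close>.
\<close>

section \<open>Power series and polynomial evaluation\<close>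

text \<open>The root attached to an entry of \<open>ys\<close> is not nilpotent in general: its
  \<open>p ^ i\<close>-th power in \<open>B i\<close> is the entry itself, carried up the tower. A
  compatible lift has the same power, so subtracting it removes the obstruction. The exponent
  \<open>p ^ i\<close> arises because each stage contributes one factor \<open>p\<close>, starting
  from exponent 1 at stage 0. The main difficulty is that no further relations hold.
  \<open>B i\<close> is built over the previous stage of its own tower and not over
  \<open>A i\<close>, so the kernel of evaluation at the \<tau> i j is not visible from the
  construction. It is bounded by induction on the stage, by mapping \<open>B i\<close> back to the
  truncated polynomial ring. The transition maps fix the variables and act only on coefficients,
  which is why the limit has coefficients in the limit of the \<open>A i\<close>. A coefficient at a
  given monomial is visible in stage \<open>i\<close> only once all its exponents are below
  \<open>p ^ i\<close>, so the limit arguments work with tails of the inverse system.\<close>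

lemma (in comm_monoid) finprod_Sigma:
  assumes "finite A" "\<And>a. a \<in> A \<Longrightarrow> finite (B a)"
    and "\<And>a b. a \<in> A \<Longrightarrow> b \<in> B a \<Longrightarrow> f a b \<in> carrier G"
  shows "(\<Otimes>x\<in>Sigma A B. f (fst x) (snd x)) = (\<Otimes>a\<in>A. \<Otimes>b\<in>B a. f a b)"
proof -
  have "Sigma A B = (\<Union>a\<in>A. Pair a ` B a)" by auto
  then have "(\<Otimes>x\<in>Sigma A B. f (fst x) (snd x))
      = (\<Otimes>a\<in>A. \<Otimes>x\<in>Pair a ` B a. f (fst x) (snd x))"
    using assms by (simp only:) (rule finprod_UN_disjoint, auto simp: pairwise_def disjnt_def)
  also have "\<dots> = (\<Otimes>a\<in>A. \<Otimes>b\<in>B a. f a b)"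
  proof (rule finprod_cong')
    fix a assume "a \<in> A"
    then show "(\<Otimes>x\<in>Pair a ` B a. f (fst x) (snd x)) = (\<Otimes>b\<in>B a. f a b)"
      using assms by (subst finprod_reindex) (auto simp: inj_on_def)
  qed (use assms in \<open>auto intro!: finprod_closed\<close>)
  finally show ?thesis .
qed

section \<open>Binomial theorem and Frobenius\<close>

context cring
begin

lemma binomial_expansion:
  assumes [simp]: "a \<in> carrier R" "b \<in> carrier R"
  shows "(a \<oplus> b) [^] (n::nat) = (\<Oplus>k\<in>{..n}. add_pow R (n choose k) (a [^] k \<otimes> b [^] (n - k)))"
proof (induction n)
  case 0
  then show ?case by (simp add: add.nat_pow_eone)
next
  case (Suc n)
  define c where "c = (\<lambda>k. a [^] Suc k \<otimes> b [^] (n - k))"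
  have [simp]: "c k \<in> carrier R" for k by (simp add: c_def)
  have bb: "b [^] Suc n = add_pow R (Suc n choose 0) (a [^] (0::nat) \<otimes> b [^] (Suc n - 0))"
    by (simp add: add.nat_pow_eone)
  have A: "(\<Oplus>k\<in>{..n}. add_pow R (n choose k) (a [^] k \<otimes> b [^] (n - k))) \<otimes> a = (\<Oplus>k\<in>{..n}. add_pow R (n choose k) (c k))"
  proof -
    have "(a [^] k \<otimes> b [^] (n - k)) \<otimes> a = c k" for k by (simp add: c_def m_ac)
    then show ?thesis by (subst finsum_ldistr) (auto intro!: finsum_cong' simp: add_pow_ldistr)
  qed
  have "(\<Oplus>k\<in>{..n}. add_pow R (n choose k) (a [^] k \<otimes> b [^] (n - k))) \<otimes> b
     = (\<Oplus>k\<in>{..n}. add_pow R (n choose k) (a [^] k \<otimes> b [^] (Suc n - k)))"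
  proof -
    have "(a [^] k \<otimes> b [^] (n - k)) \<otimes> b = a [^] k \<otimes> b [^] (Suc n - k)" if "k \<le> n" for k
      using that by (simp add: m_assoc Suc_diff_le)
    then show ?thesis by (subst finsum_ldistr) (auto intro!: finsum_cong' simp: add_pow_ldistr)
  qed
  \<comment> \<open>The added index \<open>Suc n\<close> carries the coefficient
    \<open>n choose Suc n\<close>, which is 0. Splitting off index 0 afterwards leaves a shifted sum
    that Pascal's rule combines with \<open>A\<close>.\<close>
  also have "\<dots> = (\<Oplus>k\<in>{..Suc n}. add_pow R (n choose k) (a [^] k \<otimes> b [^] (Suc n - k)))"
    by (simp add: Pi_def binomial_eq_0)
  also have "\<dots> = (\<Oplus>k\<in>{..n}. add_pow R (n choose Suc k) (c k)) \<oplus> b [^] Suc n"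
    by (subst finsum_Suc2) (auto simp: c_def add.nat_pow_eone)
  finally have B: "(\<Oplus>k\<in>{..n}. add_pow R (n choose k) (a [^] k \<otimes> b [^] (n - k))) \<otimes> b
     = (\<Oplus>k\<in>{..n}. add_pow R (n choose Suc k) (c k)) \<oplus> b [^] Suc n" .
  have "(a \<oplus> b) [^] Suc n = (\<Oplus>k\<in>{..n}. add_pow R (n choose k) (c k)) \<oplus> ((\<Oplus>k\<in>{..n}. add_pow R (n choose Suc k) (c k)) \<oplus> b [^] Suc n)"
    using Suc A B by (simp add: r_distr)
  also have "\<dots> = (\<Oplus>k\<in>{..n}. add_pow R (Suc n choose Suc k) (c k)) \<oplus> b [^] Suc n"
    by (simp add: a_assoc[symmetric] finsum_addf[symmetric] Pi_def add.nat_pow_mult)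
  also have "\<dots> = (\<Oplus>k\<in>{..Suc n}. add_pow R (Suc n choose k) (a [^] k \<otimes> b [^] (Suc n - k)))"
    by (subst finsum_Suc2) (auto simp: c_def add.nat_pow_eone)
  finally show ?case .
qed

lemma add_pow_has_char:
  assumes "has_char p R" "p dvd n" "a \<in> carrier R"
  shows "add_pow R (n) a = \<zero>"
proof -
  obtain k where n: "n = p * k" using assms(2) by (auto simp: dvd_def)
  have "add_pow R (p) a = (add_pow R (p) \<one>) \<otimes> a" using assms(3) by (simp add: add_pow_ldistr)
  then have "add_pow R (p) a = \<zero>" using assms by (simp add: has_char_def)
  moreover have "add_pow R k \<zero> = \<zero>" by (simp add: add.nat_pow_one)
  ultimately show ?thesis using add.nat_pow_pow[of a k p] assms(3) by (simp add: n)
qed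

text \<open>In the binomial expansion every inner coefficient is divisible by the prime
  \<open>p\<close>, so only the two extreme terms survive.\<close>

lemma frobenius_add:
  assumes p: "Factorial_Ring.prime p" "has_char p R" and [simp]: "a \<in> carrier R" "b \<in> carrier R"
  shows "(a \<oplus> b) [^] p = a [^] p \<oplus> b [^] p"
proof -
  have p0: "0 < p" using p(1) by (simp add: prime_gt_0_nat)
  define t where "t = (\<lambda>k. add_pow R (p choose k) (a [^] k \<otimes> b [^] (p - k)))"
  have [simp]: "t k \<in> carrier R" for k by (simp add: t_def)
  have "(a \<oplus> b) [^] p = finsum R t {..p}" by (simp add: binomial_expansion t_def)
  also have "\<dots> = finsum R t {0, p}"
  proof (rule add.finprod_mono_neutral_cong_right)
    fix k assume "k \<in> {..p} - {0, p}"
    then have "p dvd p choose k" using p(1) by (intro dvd_choose_prime) auto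
    then show "t k = \<zero>" using p by (simp add: t_def add_pow_has_char)
  qed auto
  also have "\<dots> = a [^] p \<oplus> b [^] p" using p0 by (simp add: t_def add.nat_pow_eone a_comm)
  finally show ?thesis .
qed

lemma frobenius_hom:
  assumes "Factorial_Ring.prime p" "has_char p R"
  shows "(\<lambda>a. a [^] p) \<in> ring_hom R R"
  by (intro ring_hom_memI) (auto simp: frobenius_add[OF assms] nat_pow_distrib)

end

text \<open>Since \<open>finsum\<close> over an infinite set is zero by convention, the convolution
  in \<open>series_mult\<close> is meaningful only through this finiteness.\<close>

lemma finite_submultisets: "finite {N. N \<subseteq># M}"
proof (induction M)
  case (add x M)
  have "{N. N \<subseteq># add_mset x M} \<subseteq> {N. N \<subseteq># M} \<union> add_mset x ` {N. N \<subseteq># M}"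
  proof
    fix N assume "N \<in> {N. N \<subseteq># add_mset x M}"
    then have N: "N \<subseteq># add_mset x M" by simp
    show "N \<in> {N. N \<subseteq># M} \<union> add_mset x ` {N. N \<subseteq># M}"
    proof (cases "x \<in># N")
      case True
      then obtain N' where "N = add_mset x N'" by (metis multi_member_split)
      then show ?thesis using N by auto
    next
      case False
      then show ?thesis using N by (auto simp: subseteq_mset_def not_in_iff split: if_splits) (metis le0)
    qed
  qed
  then show ?case using add by (meson finite_UnI finite_imageI finite_subset)
qed simp

section \<open>Rings of formal power series\<close>

context cring
begin

lemma series_ring_simps [simp]:
  "carrier (series_ring R I) =
     {f. (\<forall>M. f M \<in> carrier R) \<and> (\<forall>M. \<not> set_mset M \<subseteq> I \<longrightarrow> f M = \<zero>)}"
  "f \<otimes>\<^bsub>series_ring R I\<^esub> g = series_mult R f g"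
  "f \<oplus>\<^bsub>series_ring R I\<^esub> g = (\<lambda>M. f M \<oplus> g M)"
  "\<one>\<^bsub>series_ring R I\<^esub> = indexed_const \<one>"
  "\<zero>\<^bsub>series_ring R I\<^esub> = (\<lambda>M. \<zero>)"
  by (simp_all add: series_ring_def indexed_padd_def indexed_const_def)

lemma series_mult_closed:
  assumes "\<And>M. f M \<in> carrier R" "\<And>M. g M \<in> carrier R"
  shows "series_mult R f g M \<in> carrier R"
  using assms by (auto simp: series_mult_def intro!: finsum_closed)

text \<open>Sending \<open>N\<close> to \<open>M - N\<close> is an involution of the submultisets of
  \<open>M\<close> that exchanges the two factors.\<close>

lemma series_mult_comm:
  fixes f g :: "'c multiset \<Rightarrow> 'a"
  assumes "\<And>M. f M \<in> carrier R" "\<And>M. g M \<in> carrier R"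
  shows "series_mult R f g = series_mult R g f"
proof
  fix M :: "'c multiset"
  have dd: "M - (M - N) = N" if "N \<subseteq># M" for N
    using that by (simp add: multiset_eq_iff subseteq_mset_def)
  have im: "(\<lambda>N. M - N) ` {N. N \<subseteq># M} = {N. N \<subseteq># M}"
  proof (intro equalityI subsetI)
    fix N assume "N \<in> {N. N \<subseteq># M}"
    then have "N = M - (M - N)" by (simp add: dd)
    then show "N \<in> (\<lambda>N. M - N) ` {N. N \<subseteq># M}" by (metis diff_subset_eq_self image_eqI mem_Collect_eq)
  qed auto
  have inj: "inj_on (\<lambda>N. M - N) {N. N \<subseteq># M}"
    by (rule inj_on_inverseI[of _ "\<lambda>N. M - N"]) (simp add: dd)
  show "series_mult R f g M = series_mult R g f M"
    unfolding series_mult_def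
    using assms
    by (subst im[symmetric], subst finsum_reindex[OF _ inj])
      (auto intro!: finsum_cong' simp: m_comm dd)
qed

text \<open>Both sides sum \<open>f L \<otimes> (g K \<otimes> h J)\<close> over all decompositions
  of \<open>M\<close> as \<open>L + K + J\<close>. \<open>A\<close> records a decomposition as
  \<open>(L + K, L)\<close> and \<open>B\<close> as \<open>(L, K)\<close>.\<close>

lemma series_mult_assoc:
  fixes f g h :: "'c multiset \<Rightarrow> 'a"
  assumes [simp]: "\<And>M. f M \<in> carrier R" "\<And>M. g M \<in> carrier R" "\<And>M. h M \<in> carrier R"
  shows "series_mult R (series_mult R f g) h = series_mult R f (series_mult R g h)"
proof
  fix M :: "'c multiset"
  define A where "A = (SIGMA N:{N. N \<subseteq># M}. {L. L \<subseteq># N})"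
  define B where "B = (SIGMA L:{L. L \<subseteq># M}. {K. K \<subseteq># M - L})"
  define t where "t = (\<lambda>L K J. f L \<otimes> (g K \<otimes> h J))"
  have t [simp]: "t L K J \<in> carrier R" for L K J by (simp add: t_def)
  have inj: "inj_on (\<lambda>(L, K). (L + K, L)) B" by (auto simp: inj_on_def)
  have im: "(\<lambda>(L, K). (L + K, L)) ` B = A"
  proof (intro equalityI subsetI)
    fix x assume "x \<in> A"
    then obtain N L where x: "x = (N, L)" "N \<subseteq># M" "L \<subseteq># N" by (auto simp: A_def)
    then have "(L, N - L) \<in> B"
      by (auto simp: B_def subseteq_mset_def diff_le_mono intro: order_trans)
    then show "x \<in> (\<lambda>(L, K). (L + K, L)) ` B" using x by (force simp: image_iff)
  qed (auto simp: A_def B_def subseteq_mset_def, metis add.commute le_diff_conv2)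
  have "series_mult R (series_mult R f g) h M
      = (\<Oplus>N\<in>{N. N \<subseteq># M}. \<Oplus>L\<in>{L. L \<subseteq># N}. t L (N - L) (M - N))"
    unfolding series_mult_def
    by (intro finsum_cong') (auto simp: finsum_ldistr[OF finite_submultisets] t_def m_assoc Pi_def
        intro!: finsum_closed)
  also have "\<dots> = (\<Oplus>x\<in>A. t (snd x) (fst x - snd x) (M - fst x))"
    unfolding A_def by (rule add.finprod_Sigma[symmetric]) (auto simp: finite_submultisets)
  also have "\<dots> = (\<Oplus>x\<in>B. t (fst x) (snd x) (M - fst x - snd x))"
    unfolding im[symmetric] by (subst finsum_reindex[OF _ inj]) (auto intro!: finsum_cong')
  also have "\<dots> = (\<Oplus>L\<in>{L. L \<subseteq># M}. \<Oplus>K\<in>{K. K \<subseteq># M - L}. t L K (M - L - K))"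
    unfolding B_def by (rule add.finprod_Sigma) (auto simp: finite_submultisets)
  also have "\<dots> = series_mult R f (series_mult R g h) M"
    unfolding series_mult_def
    by (intro finsum_cong') (auto simp: finsum_rdistr[OF finite_submultisets] t_def Pi_def
        intro!: finsum_closed)
  finally show "series_mult R (series_mult R f g) h M = series_mult R f (series_mult R g h) M" .
qed

lemma indexed_const_mult:
  assumes "a \<in> carrier R" "\<And>M. g M \<in> carrier R"
  shows "series_mult R (indexed_const a) g = (\<lambda>M. a \<otimes> g M)"
proof
  fix M
  have "series_mult R (indexed_const a) g M = (\<Oplus>N\<in>{{#}}. indexed_const a N \<otimes> g (M - N))"
    unfolding series_mult_def using assms
    by (intro add.finprod_mono_neutral_cong_right) (auto simp: indexed_const_def finite_submultisets)
  then show "series_mult R (indexed_const a) g M = a \<otimes> g M"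
    using assms by (simp add: indexed_const_def)
qed

lemma indexed_var_apply: "indexed_var i M = (if M = {#i#} then \<one> else \<zero>)"
  by (auto simp: indexed_var_def indexed_pmult_def indexed_const_def
      dest!: multi_member_split)

lemma indexed_var_mult:
  assumes "\<And>M. g M \<in> carrier R"
  shows "series_mult R (indexed_var i) g = indexed_pmult g i"
proof
  fix M
  have "series_mult R (indexed_var i) g M = (\<Oplus>N\<in>{N. N \<subseteq># M \<and> N = {#i#}}. indexed_var i N \<otimes> g (M - N))"
    unfolding series_mult_def using assms
    by (intro add.finprod_mono_neutral_cong_right) (auto simp: indexed_var_apply finite_submultisets)
  moreover have "{N. N \<subseteq># M \<and> N = {#i#}} = (if i \<in># M then {{#i#}} else {})" by auto
  ultimately show "series_mult R (indexed_var i) g M = indexed_pmult g i M"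
    using assms by (simp add: indexed_var_apply indexed_pmult_def)
qed

text \<open>Serves twice: products involve only variables of \<open>I\<close>, and products with an
  element of the truncation ideal vanish at small monomials.\<close>

lemma series_mult_support:
  assumes "\<And>M. f M \<in> carrier R" "\<And>M. g M \<in> carrier R"
    and "\<And>N. N \<subseteq># M \<Longrightarrow> f N = \<zero> \<or> g (M - N) = \<zero>"
  shows "series_mult R f g M = \<zero>"
  unfolding series_mult_def using assms by (intro add.finprod_one_eqI) fastforce

lemma series_ring_cring: "cring (series_ring R I)"
proof (rule cringI)
  have "indexed_const \<one> M = \<zero>" if "\<not> set_mset M \<subseteq> I" for M
    using that by (auto simp: indexed_const_def)
  then have in_carrier: "indexed_const \<one> \<in> carrier (series_ring R I)"
    by (simp add: indexed_const_def)
  show "abelian_group (series_ring R I)"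
  proof (rule abelian_groupI)
    fix f assume "f \<in> carrier (series_ring R I)"
    then show "\<exists>g\<in>carrier (series_ring R I). g \<oplus>\<^bsub>series_ring R I\<^esub> f = \<zero>\<^bsub>series_ring R I\<^esub>"
      by (intro bexI[of _ "\<lambda>M. \<ominus> f M"]) (auto simp: l_neg)
  qed (auto simp: a_ac)
  show "comm_monoid (series_ring R I)"
  proof (rule comm_monoidI)
    fix f g assume *: "f \<in> carrier (series_ring R I)" "g \<in> carrier (series_ring R I)"
    show "f \<otimes>\<^bsub>series_ring R I\<^esub> g \<in> carrier (series_ring R I)"
    proof -
      have "series_mult R f g M = \<zero>" if M: "\<not> set_mset M \<subseteq> I" for M
      proof (rule series_mult_support)
        fix N assume "N \<subseteq># M"
        then have "set_mset M = set_mset N \<union> set_mset (M - N)"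
          by (metis set_mset_union subset_mset.add_diff_inverse)
        then show "f N = \<zero> \<or> g (M - N) = \<zero>" using * M by auto
      qed (use * in auto)
      then show ?thesis using * by (auto simp: series_mult_closed)
    qed
    show "f \<otimes>\<^bsub>series_ring R I\<^esub> g = g \<otimes>\<^bsub>series_ring R I\<^esub> f"
      using * by (auto simp: series_mult_comm)
  next
    fix f g h assume "f \<in> carrier (series_ring R I)" "g \<in> carrier (series_ring R I)"
      "h \<in> carrier (series_ring R I)"
    then show "f \<otimes>\<^bsub>series_ring R I\<^esub> g \<otimes>\<^bsub>series_ring R I\<^esub> h = f \<otimes>\<^bsub>series_ring R I\<^esub> (g \<otimes>\<^bsub>series_ring R I\<^esub> h)"
      by (auto simp: series_mult_assoc)
  next
    show "\<one>\<^bsub>series_ring R I\<^esub> \<in> carrier (series_ring R I)"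
      using in_carrier by simp
    fix f assume "f \<in> carrier (series_ring R I)"
    then show "\<one>\<^bsub>series_ring R I\<^esub> \<otimes>\<^bsub>series_ring R I\<^esub> f = f"
      by (simp add: indexed_const_mult)
  qed
  fix f g h assume "f \<in> carrier (series_ring R I)" "g \<in> carrier (series_ring R I)"
    "h \<in> carrier (series_ring R I)"
  then have [simp]: "f M \<in> carrier R" "g M \<in> carrier R" "h M \<in> carrier R" for M by auto
  have "series_mult R (\<lambda>M. f M \<oplus> g M) h M = series_mult R f h M \<oplus> series_mult R g h M" for M
  proof -
    have "series_mult R (\<lambda>M. f M \<oplus> g M) h M
        = (\<Oplus>N\<in>{N. N \<subseteq># M}. (f N \<otimes> h (M - N)) \<oplus> (g N \<otimes> h (M - N)))"
      unfolding series_mult_def by (intro finsum_cong') (auto simp: l_distr)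
    also have "\<dots> = series_mult R f h M \<oplus> series_mult R g h M"
      unfolding series_mult_def by (intro finsum_addf) auto
    finally show ?thesis .
  qed
  then show "(f \<oplus>\<^bsub>series_ring R I\<^esub> g) \<otimes>\<^bsub>series_ring R I\<^esub> h =
      f \<otimes>\<^bsub>series_ring R I\<^esub> h \<oplus>\<^bsub>series_ring R I\<^esub> g \<otimes>\<^bsub>series_ring R I\<^esub> h"
    by (simp add: fun_eq_iff)
qed

section \<open>Polynomials as finitely supported series\<close>

abbreviation "pset I \<equiv> indexed_pset I (carrier R)"

lemma pset_coeff: "f \<in> pset I \<Longrightarrow> f M \<in> carrier R"
  using indexed_pset_in_carrier[of "carrier R" f] by (auto simp: carrier_coeff_def)

lemma pset_support: "f \<in> pset I \<Longrightarrow> \<not> set_mset M \<subseteq> I \<Longrightarrow> f M = \<zero>"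
proof (induction arbitrary: M rule: indexed_pset.induct)
  case (indexed_pmult P i)
  have "\<not> set_mset (M - {#i#}) \<subseteq> I" if "i \<in># M"
    using multi_member_split[OF that] indexed_pmult by auto
  then show ?case using indexed_pmult by (simp add: indexed_pmult_def)
qed (auto simp: indexed_const_def indexed_padd_def)

lemma pset_subset: "pset I \<subseteq> carrier (series_ring R I)"
  using pset_support by (fastforce simp: pset_coeff)

lemma pset_finite_support: "f \<in> pset I \<Longrightarrow> finite {M. f M \<noteq> \<zero>}"
proof (induction rule: indexed_pset.induct)
  case (indexed_const k)
  have "{M. indexed_const k M \<noteq> \<zero>} \<subseteq> {{#}}" by (auto simp: indexed_const_def)
  then show ?case by (rule finite_subset) simp
next
  case (indexed_padd P Q)
  have "{M. indexed_padd P Q M \<noteq> \<zero>} \<subseteq> {M. P M \<noteq> \<zero>} \<union> {M. Q M \<noteq> \<zero>}" by (auto simp: indexed_padd_def)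
  then show ?case using indexed_padd by (meson finite_UnI finite_subset)
next
  case (indexed_pmult P i)
  have "{M. indexed_pmult P i M \<noteq> \<zero>} \<subseteq> add_mset i ` {M. P M \<noteq> \<zero>}"
    by (auto simp: indexed_pmult_def dest!: multi_member_split split: if_splits)
  then show ?case using indexed_pmult by (meson finite_imageI finite_subset)
qed

lemma pset_smult:
  fixes f :: "'c multiset \<Rightarrow> 'a"
  shows "f \<in> pset I \<Longrightarrow> a \<in> carrier R \<Longrightarrow> (\<lambda>M. a \<otimes> f M) \<in> pset I"
proof (induction rule: indexed_pset.induct)
  case (indexed_const k)
  have "(\<lambda>M :: 'c multiset. a \<otimes> indexed_const k M) = indexed_const (a \<otimes> k)"
    using indexed_const by (auto simp: indexed_const_def fun_eq_iff)
  then show ?case using indexed_const by (simp add: indexed_pset.indexed_const)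
next
  case (indexed_padd P Q)
  have "(\<lambda>M. a \<otimes> indexed_padd P Q M) = indexed_padd (\<lambda>M. a \<otimes> P M) (\<lambda>M. a \<otimes> Q M)"
    using indexed_padd by (auto simp: indexed_padd_def fun_eq_iff r_distr pset_coeff)
  then show ?case using indexed_padd by (simp add: indexed_pset.indexed_padd)
next
  case (indexed_pmult P i)
  have "(\<lambda>M. a \<otimes> indexed_pmult P i M) = indexed_pmult (\<lambda>M. a \<otimes> P M) i"
    using indexed_pmult by (auto simp: indexed_pmult_def fun_eq_iff)
  then show ?case using indexed_pmult by (simp add: indexed_pset.indexed_pmult)
qed

lemma pset_monomial: "set_mset M \<subseteq> I \<Longrightarrow> a \<in> carrier R \<Longrightarrow> (\<lambda>N. if N = M then a else \<zero>) \<in> pset I"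
proof (induction M)
  case empty
  then show ?case using indexed_pset.indexed_const[of a "carrier R" I] by (simp add: indexed_const_def)
next
  case (add i M)
  have "(\<lambda>N. if N = add_mset i M then a else \<zero>) = indexed_pmult (\<lambda>N. if N = M then a else \<zero>) i"
    by (auto simp: indexed_pmult_def fun_eq_iff dest!: multi_member_split)
  then show ?case using add by (simp add: indexed_pset.indexed_pmult)
qed

text \<open>\<open>indexed_pset\<close> is an inductive closure, which does not reveal when a given
  coefficient function is a polynomial. This criterion recognises truncated series as polynomials in
  \<open>trunc_series_closed\<close>.\<close>

lemma psetI:
  assumes "f \<in> carrier (series_ring R I)" "finite {M. f M \<noteq> \<zero>}"
  shows "f \<in> pset I"
proof -
  have "f \<in> pset I" if "finite A" "{M. f M \<noteq> \<zero>} = A" "f \<in> carrier (series_ring R I)" for A f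
    using that
  proof (induction A arbitrary: f)
    case empty
    then have "f = indexed_const \<zero>" by (auto simp: indexed_const_def)
    then show ?case by (simp add: indexed_pset.indexed_const)
  next
    case (insert M A)
    have "(f(M := \<zero>)) \<in> pset I" using insert by (intro insert.IH) auto
    moreover have "(\<lambda>N. if N = M then f M else \<zero>) \<in> pset I" using insert by (intro pset_monomial) auto
    moreover have "f = indexed_padd (f(M := \<zero>)) (\<lambda>N. if N = M then f M else \<zero>)"
      using insert by (auto simp: indexed_padd_def fun_eq_iff)
    ultimately show ?case by (metis indexed_pset.indexed_padd)
  qed
  then show ?thesis using assms by blast
qed

lemma pset_var: "i \<in> I \<Longrightarrow> indexed_var i \<in> pset I"
  by (simp add: indexed_var_def indexed_pset.intros)

lemma pset_mult: "f \<in> pset I \<Longrightarrow> g \<in> pset I \<Longrightarrow> series_mult R f g \<in> pset I"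
proof (induction rule: indexed_pset.induct)
  case (indexed_const k)
  then show ?case by (simp add: indexed_const_mult pset_coeff pset_smult)
next
  case (indexed_padd P Q)
  interpret S: cring "series_ring R I" by (rule series_ring_cring)
  have "series_mult R (indexed_padd P Q) g = indexed_padd (series_mult R P g) (series_mult R Q g)"
    using S.l_distr[of P Q g] indexed_padd pset_subset[of I] by (auto simp: indexed_padd_def)
  then show ?case using indexed_padd by (simp add: indexed_pset.indexed_padd)
next
  case (indexed_pmult P i)
  have "series_mult R (indexed_pmult P i) g = indexed_pmult (series_mult R P g) i"
    using indexed_pmult
    by (simp add: indexed_var_mult[symmetric] series_mult_closed pset_coeff series_mult_assoc
        pset_coeff[OF pset_var])
  then show ?case using indexed_pmult by (simp add: indexed_pset.indexed_pmult)
qed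

lemma poly_ring_simps [simp]:
  "carrier (indexed_poly_ring R I) = pset I"
  "f \<otimes>\<^bsub>indexed_poly_ring R I\<^esub> g = series_mult R f g"
  "f \<oplus>\<^bsub>indexed_poly_ring R I\<^esub> g = (\<lambda>M. f M \<oplus> g M)"
  "\<one>\<^bsub>indexed_poly_ring R I\<^esub> = indexed_const \<one>"
  "\<zero>\<^bsub>indexed_poly_ring R I\<^esub> = (\<lambda>M. \<zero>)"
  using series_ring_simps[of I] by (simp_all add: indexed_poly_ring_def)

lemma indexed_poly_ring_cring: "cring (indexed_poly_ring R I)"
proof -
  interpret S: cring "series_ring R I" by (rule series_ring_cring)
  have add: "(\<lambda>M. f M \<oplus> g M) \<in> pset I" if "f \<in> pset I" "g \<in> pset I" for f g
    using indexed_pset.indexed_padd[OF that] by (simp add: indexed_padd_def)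
  have "\<ominus>\<^bsub>series_ring R I\<^esub> f = (\<lambda>M. \<ominus> \<one> \<otimes> f M)" if "f \<in> pset I" for f
    using that pset_subset[of I]
    by (intro S.minus_equality) (auto simp: pset_coeff l_minus l_neg pset_support)
  then have "subring (pset I) (series_ring R I)"
    using pset_subset[of I]
    by (intro S.subringI) (auto simp: pset_smult pset_mult add indexed_pset.indexed_const)
  then show ?thesis
    using S.subcring_iff[OF pset_subset] S.subcringI' by (simp add: indexed_poly_ring_def)
qed

end

lemma (in cring) indexed_const_hom: "indexed_const \<in> ring_hom R (indexed_poly_ring R I)"
proof (rule ring_hom_memI)
  fix a b assume ab: "a \<in> carrier R" "b \<in> carrier R"
  then show "indexed_const (a \<otimes> b) = indexed_const a \<otimes>\<^bsub>indexed_poly_ring R I\<^esub> indexed_const b"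
    by (simp only: poly_ring_simps, subst indexed_const_mult) (auto simp: indexed_const_def)
  show "indexed_const (a \<oplus> b) = indexed_const a \<oplus>\<^bsub>indexed_poly_ring R I\<^esub> indexed_const b"
    by (auto simp: indexed_const_def)
qed (simp_all add: indexed_pset.indexed_const)

text \<open>Polynomials arise from constants by sums and multiplication by single variables, and
  homomorphisms respect both operations.\<close>

lemma poly_ring_hom_eq:
  assumes "cring R" and h: "h1 \<in> ring_hom (indexed_poly_ring R I) D" "h2 \<in> ring_hom (indexed_poly_ring R I) D"
    and const: "\<And>a. a \<in> carrier R \<Longrightarrow> h1 (ring.indexed_const R a) = h2 (ring.indexed_const R a)"
    and var: "\<And>i. i \<in> I \<Longrightarrow> h1 (ring.indexed_var R i) = h2 (ring.indexed_var R i)"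
    and "f \<in> carrier (indexed_poly_ring R I)"
  shows "h1 f = h2 f"
proof -
  interpret cring R by fact
  have "f \<in> pset I" using assms by simp
  then show ?thesis
  proof (induction rule: indexed_pset.induct)
    case (indexed_padd P Q)
    then show ?case using h[THEN ring_hom_add, of P Q] by (simp add: indexed_padd_def)
  next
    case (indexed_pmult P i)
    then show ?case
      using h[THEN ring_hom_mult, of "indexed_var i" P] var
      by (simp add: indexed_var_mult pset_var pset_coeff)
  qed (use const in simp)
qed

text \<open>The sum and the monomials are written as in \<open>stage_map\<close>, so that the
  transition maps of the tower become an instance by mere unfolding (\<open>phi_eq\<close>).\<close>

definition poly_eval ::
  "('a, 'b) ring_scheme \<Rightarrow> ('d, 'e) ring_scheme \<Rightarrow> ('a \<Rightarrow> 'd) \<Rightarrow> ('c \<Rightarrow> 'd) \<Rightarrow> ('c multiset \<Rightarrow> 'a) \<Rightarrow> 'd" where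
  "poly_eval R S h d f =
     (\<Oplus>\<^bsub>S\<^esub>M\<in>{M. f M \<noteq> \<zero>\<^bsub>R\<^esub>}. h (f M) \<otimes>\<^bsub>S\<^esub> (\<Otimes>\<^bsub>S\<^esub>j\<in>set_mset M. d j [^]\<^bsub>S\<^esub> count M j))"

locale poly_evaluation = ring_hom_cring R S h for R (structure) and S (structure) and h +
  fixes I :: "'i set" and d
  assumes d_closed: "i \<in> I \<Longrightarrow> d i \<in> carrier S"
begin

definition monomial where
  "monomial M = (\<Otimes>\<^bsub>S\<^esub>j\<in>set_mset M. d j [^]\<^bsub>S\<^esub> count M j)"

lemma monomial_closed [simp]: "set_mset M \<subseteq> I \<Longrightarrow> monomial M \<in> carrier S"
  by (auto simp: monomial_def intro!: S.finprod_closed S.nat_pow_closed d_closed)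

lemma monomial_empty [simp]: "monomial {#} = \<one>\<^bsub>S\<^esub>"
  by (simp add: monomial_def)

text \<open>Absent variables contribute exponent 0, so the product may run over a larger set
  \<open>A\<close>. This lets \<open>M\<close> and \<open>add_mset i M\<close> be compared over one
  index set, even when \<open>i\<close> is new.\<close>

lemma monomial_split:
  assumes "finite A" "set_mset M \<subseteq> A" "i \<in> A" "A \<subseteq> I"
  shows "monomial M = d i [^]\<^bsub>S\<^esub> count M i \<otimes>\<^bsub>S\<^esub> (\<Otimes>\<^bsub>S\<^esub>j\<in>A - {i}. d j [^]\<^bsub>S\<^esub> count M j)"
proof -
  have "monomial M = (\<Otimes>\<^bsub>S\<^esub>j\<in>A. d j [^]\<^bsub>S\<^esub> count M j)"
    unfolding monomial_def using assms d_closed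
    by (intro S.finprod_mono_neutral_cong_left) (auto simp: not_in_iff)
  also have "A = insert i (A - {i})" using assms by auto
  also have "(\<Otimes>\<^bsub>S\<^esub>j\<in>insert i (A - {i}). d j [^]\<^bsub>S\<^esub> count M j)
      = d i [^]\<^bsub>S\<^esub> count M i \<otimes>\<^bsub>S\<^esub> (\<Otimes>\<^bsub>S\<^esub>j\<in>A - {i}. d j [^]\<^bsub>S\<^esub> count M j)"
    using assms d_closed by (intro S.finprod_insert) auto
  finally show ?thesis .
qed

lemma monomial_add_mset:
  assumes "set_mset M \<subseteq> I" "i \<in> I"
  shows "monomial (add_mset i M) = d i \<otimes>\<^bsub>S\<^esub> monomial M"
proof -
  let ?A = "insert i (set_mset M)"
  have c: "(\<Otimes>\<^bsub>S\<^esub>j\<in>?A - {i}. d j [^]\<^bsub>S\<^esub> count (add_mset i M) j)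
      = (\<Otimes>\<^bsub>S\<^esub>j\<in>?A - {i}. d j [^]\<^bsub>S\<^esub> count M j)"
    using assms d_closed by (intro S.finprod_cong') auto
  have P: "(\<Otimes>\<^bsub>S\<^esub>j\<in>?A - {i}. d j [^]\<^bsub>S\<^esub> count M j) \<in> carrier S"
    using assms d_closed by (intro S.finprod_closed) auto
  have "monomial (add_mset i M) = d i [^]\<^bsub>S\<^esub> Suc (count M i) \<otimes>\<^bsub>S\<^esub> (\<Otimes>\<^bsub>S\<^esub>j\<in>?A - {i}. d j [^]\<^bsub>S\<^esub> count M j)"
    using monomial_split[of ?A "add_mset i M" i] assms unfolding c by simp
  also have "\<dots> = d i \<otimes>\<^bsub>S\<^esub> (d i [^]\<^bsub>S\<^esub> count M i \<otimes>\<^bsub>S\<^esub> (\<Otimes>\<^bsub>S\<^esub>j\<in>?A - {i}. d j [^]\<^bsub>S\<^esub> count M j))"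
    using P d_closed[OF assms(2)] by (simp add: S.m_ac del: insert_Diff_single Diff_insert)
  also have "\<dots> = d i \<otimes>\<^bsub>S\<^esub> monomial M"
    by (subst monomial_split[of ?A M i]) (use assms in auto)
  finally show ?thesis .
qed

lemma monomial_eq_zero:
  assumes "set_mset M \<subseteq> I" "i \<in># M" "d i [^]\<^bsub>S\<^esub> k = \<zero>\<^bsub>S\<^esub>" "k \<le> count M i"
  shows "monomial M = \<zero>\<^bsub>S\<^esub>"
proof -
  have i: "d i \<in> carrier S" using assms d_closed by auto
  have "d i [^]\<^bsub>S\<^esub> count M i = d i [^]\<^bsub>S\<^esub> k \<otimes>\<^bsub>S\<^esub> d i [^]\<^bsub>S\<^esub> (count M i - k)"
    using assms(4) i by (simp add: S.nat_pow_mult)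
  moreover have "(\<Otimes>\<^bsub>S\<^esub>j\<in>set_mset M - {i}. d j [^]\<^bsub>S\<^esub> count M j) \<in> carrier S"
    using assms d_closed by (intro S.finprod_closed) auto
  ultimately show ?thesis
    using assms i by (subst monomial_split[of "set_mset M" M i]) simp_all
qed

abbreviation "ev \<equiv> poly_eval R S h d"

text \<open>Supports change under addition because of cancellation; a common finite index set for
  all polynomials in an identity removes that dependence.\<close>

lemma ev_superset:
  assumes "f \<in> R.pset I" "finite A" "{M. f M \<noteq> \<zero>} \<subseteq> A" "\<And>M. M \<in> A \<Longrightarrow> set_mset M \<subseteq> I"
  shows "ev f = (\<Oplus>\<^bsub>S\<^esub>M\<in>A. h (f M) \<otimes>\<^bsub>S\<^esub> monomial M)"
proof -
  have f: "f M \<in> carrier R" for M using assms(1) by (rule R.pset_coeff)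
  show ?thesis
    unfolding poly_eval_def monomial_def[symmetric]
    by (rule S.add.finprod_mono_neutral_cong_left) (use assms f in auto)
qed

lemma ev_closed:
  assumes "f \<in> R.pset I"
  shows "ev f \<in> carrier S"
  unfolding poly_eval_def monomial_def[symmetric]
proof (intro S.finsum_closed funcsetI)
  fix M assume "M \<in> {M. f M \<noteq> \<zero>}"
  then have "set_mset M \<subseteq> I" using R.pset_support[OF assms] by auto
  then show "h (f M) \<otimes>\<^bsub>S\<^esub> monomial M \<in> carrier S" using R.pset_coeff[OF assms] by simp
qed

lemma ev_const [simp]: "a \<in> carrier R \<Longrightarrow> ev (R.indexed_const a) = h a"
  by (subst ev_superset[of _ "{{#}}"], rule R.indexed_pset.indexed_const)
    (auto simp: R.indexed_const_def split: if_splits)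

lemma ev_add:
  assumes "f \<in> R.pset I" "g \<in> R.pset I"
  shows "ev (R.indexed_padd f g) = ev f \<oplus>\<^bsub>S\<^esub> ev g"
proof -
  let ?A = "{M. f M \<noteq> \<zero>} \<union> {M. g M \<noteq> \<zero>}"
  have A: "finite ?A" using assms by (auto intro: R.pset_finite_support)
  have A2: "\<And>M. M \<in> ?A \<Longrightarrow> set_mset M \<subseteq> I"
    by (use assms[THEN R.pset_support] in blast)
  have "R.indexed_padd f g \<in> R.pset I" using assms by (rule R.indexed_pset.indexed_padd)
  moreover have "{M. R.indexed_padd f g M \<noteq> \<zero>} \<subseteq> ?A" by (auto simp: R.indexed_padd_def)
  ultimately have "ev (R.indexed_padd f g) = (\<Oplus>\<^bsub>S\<^esub>M\<in>?A. h (R.indexed_padd f g M) \<otimes>\<^bsub>S\<^esub> monomial M)"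
    using A A2 by (intro ev_superset)
  also have "\<dots> = (\<Oplus>\<^bsub>S\<^esub>M\<in>?A. (h (f M) \<otimes>\<^bsub>S\<^esub> monomial M) \<oplus>\<^bsub>S\<^esub> (h (g M) \<otimes>\<^bsub>S\<^esub> monomial M))"
    using assms[THEN R.pset_coeff] A A2 by (intro S.finsum_cong') (auto simp: R.indexed_padd_def S.l_distr)
  also have "\<dots> = (\<Oplus>\<^bsub>S\<^esub>M\<in>?A. h (f M) \<otimes>\<^bsub>S\<^esub> monomial M) \<oplus>\<^bsub>S\<^esub> (\<Oplus>\<^bsub>S\<^esub>M\<in>?A. h (g M) \<otimes>\<^bsub>S\<^esub> monomial M)"
    using assms[THEN R.pset_coeff] A A2 by (intro S.finsum_addf) auto
  also have "\<dots> = ev f \<oplus>\<^bsub>S\<^esub> ev g"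
    using A A2 assms by (subst (1 2) ev_superset[where A = ?A]) auto
  finally show ?thesis .
qed

lemma ev_pmult:
  assumes f: "f \<in> R.pset I" and i: "i \<in> I"
  shows "ev (R.indexed_pmult f i) = d i \<otimes>\<^bsub>S\<^esub> ev f"
proof -
  let ?A = "{M. f M \<noteq> \<zero>}"
  have A: "finite ?A" using f by (rule R.pset_finite_support)
  have A2: "\<And>M. M \<in> ?A \<Longrightarrow> set_mset M \<subseteq> I"
    by (use R.pset_support[OF f] in blast)
  have fM: "f M \<in> carrier R" for M using f by (rule R.pset_coeff)
  have "ev (R.indexed_pmult f i)
      = (\<Oplus>\<^bsub>S\<^esub>M\<in>add_mset i ` ?A. h (R.indexed_pmult f i M) \<otimes>\<^bsub>S\<^esub> monomial M)"
  proof (rule ev_superset)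
    show "{M. R.indexed_pmult f i M \<noteq> \<zero>} \<subseteq> add_mset i ` ?A"
      by (auto simp: R.indexed_pmult_def dest!: multi_member_split split: if_splits)
    show "set_mset N \<subseteq> I" if "N \<in> add_mset i ` ?A" for N using that A2 i by fastforce
  qed (use A f i in \<open>auto intro: R.indexed_pset.indexed_pmult\<close>)
  also have "\<dots> = (\<Oplus>\<^bsub>S\<^esub>M\<in>?A. h (f M) \<otimes>\<^bsub>S\<^esub> monomial (add_mset i M))"
    using A A2 i fM by (subst S.finsum_reindex) (auto simp: R.indexed_pmult_def inj_on_def intro!: S.m_closed)
  also have "\<dots> = (\<Oplus>\<^bsub>S\<^esub>M\<in>?A. d i \<otimes>\<^bsub>S\<^esub> (h (f M) \<otimes>\<^bsub>S\<^esub> monomial M))"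
    using A A2 i fM d_closed[OF i] by (intro S.finsum_cong') (auto simp: monomial_add_mset S.m_ac)
  also have "\<dots> = d i \<otimes>\<^bsub>S\<^esub> ev f"
    using A A2 i fM d_closed[OF i] f
    by (subst ev_superset[where A = ?A]) (auto simp: S.finsum_rdistr Pi_def)
  finally show ?thesis .
qed

lemma ev_var [simp]: "i \<in> I \<Longrightarrow> ev (R.indexed_var i) = d i"
  by (simp add: R.indexed_var_def ev_pmult R.indexed_pset.indexed_const d_closed)

text \<open>Induction on the left factor reduces the convolution to scalar multiples, sums and
  multiplication by one variable, so no double sum has to be rearranged.\<close>

lemma ev_mult:
  assumes "f \<in> R.pset I" "g \<in> R.pset I"
  shows "ev (series_mult R f g) = ev f \<otimes>\<^bsub>S\<^esub> ev g"
  using assms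
proof (induction rule: R.indexed_pset.induct)
  case (indexed_const k)
  note g = R.pset_coeff[OF \<open>g \<in> R.pset I\<close>]
  let ?A = "{M. g M \<noteq> \<zero>}"
  have A: "finite ?A" using \<open>g \<in> R.pset I\<close> by (rule R.pset_finite_support)
  have A2: "\<And>M. M \<in> ?A \<Longrightarrow> set_mset M \<subseteq> I"
    by (use R.pset_support[OF \<open>g \<in> R.pset I\<close>] in blast)
  have "ev (\<lambda>M. k \<otimes> g M) = (\<Oplus>\<^bsub>S\<^esub>M\<in>?A. h (k \<otimes> g M) \<otimes>\<^bsub>S\<^esub> monomial M)"
    using A A2 indexed_const by (intro ev_superset) (auto simp: R.pset_smult)
  also have "\<dots> = (\<Oplus>\<^bsub>S\<^esub>M\<in>?A. h k \<otimes>\<^bsub>S\<^esub> (h (g M) \<otimes>\<^bsub>S\<^esub> monomial M))"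
    using A A2 indexed_const g by (intro S.finsum_cong') (auto simp: S.m_assoc)
  also have "\<dots> = h k \<otimes>\<^bsub>S\<^esub> ev g"
    using A A2 indexed_const g
    by (subst ev_superset[where A = ?A]) (auto simp: S.finsum_rdistr Pi_def)
  finally show ?case using indexed_const g by (simp add: R.indexed_const_mult)
next
  case (indexed_padd P Q)
  interpret T: cring "series_ring R I" by (rule R.series_ring_cring)
  have "series_mult R (R.indexed_padd P Q) g = R.indexed_padd (series_mult R P g) (series_mult R Q g)"
    using T.l_distr[of P Q g] indexed_padd R.pset_subset[of I] by (auto simp: R.indexed_padd_def)
  then show ?case using indexed_padd by (simp add: ev_add R.pset_mult S.l_distr ev_closed)
next
  case (indexed_pmult P i)
  have "series_mult R (R.indexed_pmult P i) g = R.indexed_pmult (series_mult R P g) i"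
    using indexed_pmult
    by (simp add: R.indexed_var_mult[symmetric] R.series_mult_closed R.pset_coeff R.series_mult_assoc
        R.pset_coeff[OF R.pset_var])
  then show ?case
    using indexed_pmult by (simp add: ev_pmult R.pset_mult S.m_assoc ev_closed d_closed)
qed

lemma ev_hom: "ev \<in> ring_hom (indexed_poly_ring R I) S"
  using ev_add by (intro ring_hom_memI) (auto simp: ev_closed ev_mult R.indexed_padd_def)

lemma ev_hom_cring: "ring_hom_cring (indexed_poly_ring R I) S ev"
  by (intro ring_hom_cring.intro ring_hom_cring_axioms.intro ev_hom R.indexed_poly_ring_cring S.is_cring)

lemma ev_eq_zero:
  assumes "f \<in> R.pset I" "\<And>M. set_mset M \<subseteq> I \<Longrightarrow> f M = \<zero> \<or> monomial M = \<zero>\<^bsub>S\<^esub>"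
  shows "ev f = \<zero>\<^bsub>S\<^esub>"
  unfolding poly_eval_def monomial_def[symmetric]
proof (rule S.add.finprod_one_eqI)
  fix M assume "M \<in> {M. f M \<noteq> \<zero>}"
  then have "f M \<noteq> \<zero>" "set_mset M \<subseteq> I" using R.pset_support[OF assms(1)] by auto
  then show "h (f M) \<otimes>\<^bsub>S\<^esub> monomial M = \<zero>\<^bsub>S\<^esub>"
    using assms(2)[of M] R.pset_coeff[OF assms(1)] by auto
qed

end

section \<open>Adjoining roots\<close>

lemma (in cring) image_ring_cring: "inj_on f (carrier R) \<Longrightarrow> cring (image_ring f R)"
  using ring_iso_imp_img_cring[OF inj_imp_image_ring_iso]
  by (simp add: image_ring_def image_group_def monoid.defs)

lemma has_char_hom:
  assumes "has_char p R" "h \<in> ring_hom R S" "cring R" "cring S"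
  shows "has_char p S"
proof -
  interpret ring_hom_cring R S h
    using assms by (simp add: ring_hom_cring_def ring_hom_cring_axioms_def)
  have "h (add_pow R n \<one>\<^bsub>R\<^esub>) = add_pow S n \<one>\<^bsub>S\<^esub>" for n :: nat
    by (induction n) simp_all
  then show ?thesis using assms(1) hom_zero by (metis has_char_def)
qed

text \<open>The quotient map from polynomials onto \<open>adjoin_roots\<close>, read through the
  encoding of cosets. On constants it gives the structure map \<open>root_incl\<close>.\<close>

definition root_class :: "nat \<Rightarrow> 'a tower ring \<Rightarrow> 'a tower list \<Rightarrow> (nat multiset \<Rightarrow> 'a tower) \<Rightarrow> 'a tower" where
  "root_class p S zs f = class_code (root_ideal p S zs +>\<^bsub>indexed_poly_ring S {..<length zs}\<^esub> f)"

definition root_incl :: "nat \<Rightarrow> 'a tower ring \<Rightarrow> 'a tower list \<Rightarrow> 'a tower \<Rightarrow> 'a tower" where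
  "root_incl p S zs a = root_class p S zs (ring.indexed_const S a)"

locale root_adjunction = S: cring S for S :: "'a tower ring" +
  fixes p :: nat and zs :: "'a tower list"
  assumes prime: "Factorial_Ring.prime p" and char: "has_char p S" and zs_closed: "set zs \<subseteq> carrier S"
begin

abbreviation "n \<equiv> length zs"
abbreviation "P \<equiv> indexed_poly_ring S {..<n}"
abbreviation "J \<equiv> root_ideal p S zs"
abbreviation "S' \<equiv> adjoin_roots p S zs"
abbreviation "cls \<equiv> root_class p S zs"
abbreviation "incl \<equiv> root_incl p S zs"
abbreviation "zs' \<equiv> adjoined_roots p S zs"

sublocale P: cring P by (rule S.indexed_poly_ring_cring)

lemma zs_nth [simp]: "j < n \<Longrightarrow> zs ! j \<in> carrier S"
  using zs_closed nth_mem by blast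

definition "gen j = S.indexed_var j [^]\<^bsub>P\<^esub> p \<ominus>\<^bsub>P\<^esub> S.indexed_const (zs ! j)"

lemma var_closed: "j < n \<Longrightarrow> S.indexed_var j \<in> carrier P"
  by (simp add: S.pset_var)

lemma const_closed: "a \<in> carrier S \<Longrightarrow> S.indexed_const a \<in> carrier P"
  by (simp add: S.indexed_pset.indexed_const)

lemma gen_closed: "j < n \<Longrightarrow> gen j \<in> carrier P"
  unfolding gen_def by (intro P.minus_closed P.nat_pow_closed var_closed const_closed zs_nth)

lemma J_eq: "J = Idl\<^bsub>P\<^esub> {gen j | j. j < n}"
  by (simp only: root_ideal_def gen_def Let_def)

lemma J_ideal: "ideal J P"
  unfolding J_eq by (intro P.genideal_ideal) (use gen_closed in blast)

sublocale J: ideal J P by (rule J_ideal)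

lemma quot_elem:
  assumes "C \<in> carrier (P Quot J)" obtains f where "f \<in> carrier P" "C = J +>\<^bsub>P\<^esub> f"
  using assms by (auto simp: FactRing_def A_RCOSETS_def')

lemma coset_eq: "f \<in> carrier P \<Longrightarrow> g \<in> J +>\<^bsub>P\<^esub> f \<Longrightarrow> J +>\<^bsub>P\<^esub> g = J +>\<^bsub>P\<^esub> f"
  by (metis P.a_repr_independence J.additive_subgroup_axioms P.add.repr_independence additive_subgroup.a_subgroup)

text \<open>Membership in the coset is all that \<open>class_code_inj\<close> and
  \<open>lift_cls\<close> use about the arbitrarily chosen representative.\<close>

lemma step_poly_cls: "f \<in> carrier P \<Longrightarrow> step_poly (cls f) \<in> J +>\<^bsub>P\<^esub> f"
  unfolding root_class_def class_code_def tower.sel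
  by (rule someI[where P = "\<lambda>g. g \<in> J +>\<^bsub>P\<^esub> f"]) (rule J.a_rcos_self)

text \<open>Cosets with the same code share their chosen representative, and two cosets of
  \<open>J\<close> with a common element coincide.\<close>

lemma class_code_inj: "inj_on class_code (carrier (P Quot J))"
proof (rule inj_onI)
  fix C D assume C: "C \<in> carrier (P Quot J)" and D: "D \<in> carrier (P Quot J)"
    and eq: "class_code C = class_code D"
  obtain f where f: "f \<in> carrier P" "C = J +>\<^bsub>P\<^esub> f" using C by (rule quot_elem)
  obtain g where g: "g \<in> carrier P" "D = J +>\<^bsub>P\<^esub> g" using D by (rule quot_elem)
  have "step_poly (cls f) = step_poly (cls g)" using eq f g by (simp add: root_class_def)
  then show "C = D" using step_poly_cls f g coset_eq by metis
qed

lemma quot_cring: "cring (P Quot J)"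
  by (rule J.quotient_is_cring[OF P.is_cring])

lemma adjoin_cring: "cring S'"
  unfolding adjoin_roots_def by (rule cring.image_ring_cring[OF quot_cring class_code_inj])

sublocale S': cring S' by (rule adjoin_cring)

lemma cls_hom: "cls \<in> ring_hom P S'"
proof -
  have "class_code \<in> ring_hom (P Quot J) S'"
    using inj_imp_image_ring_iso[OF class_code_inj] by (simp add: adjoin_roots_def ring_iso_def)
  then have "class_code \<circ> (+>\<^bsub>P\<^esub>) J \<in> ring_hom P S'"
    by (rule ring_hom_trans[OF J.rcos_ring_hom])
  then show ?thesis by (simp add: root_class_def[abs_def] comp_def)
qed

lemma cls_surj:
  assumes "a \<in> carrier S'" obtains f where "f \<in> carrier P" "a = cls f"
  using assms by (auto simp: adjoin_roots_def image_ring_carrier root_class_def elim!: quot_elem)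

sublocale cls: ring_hom_cring P S' cls
  by (intro ring_hom_cring.intro ring_hom_cring_axioms.intro cls_hom adjoin_cring P.is_cring)

lemma incl_hom: "incl \<in> ring_hom S S'"
  using ring_hom_trans[OF S.indexed_const_hom cls_hom] by (simp add: root_incl_def[abs_def] comp_def)

lemma char': "has_char p S'"
  using has_char_hom[OF char incl_hom] S.is_cring adjoin_cring by blast

lemma length_zs' [simp]: "length zs' = n"
  by (simp add: adjoined_roots_def)

lemma zs'_nth: "j < n \<Longrightarrow> zs' ! j = cls (S.indexed_var j)"
  by (simp add: adjoined_roots_def root_class_def)

lemma zs'_closed: "set zs' \<subseteq> carrier S'"
  by (auto simp: in_set_conv_nth zs'_nth cls.hom_closed[OF var_closed])

lemma zs'_pow:
  assumes "j < n" shows "zs' ! j [^]\<^bsub>S'\<^esub> p = incl (zs ! j)"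
proof -
  have "gen j \<in> J" unfolding J_eq using assms gen_closed by (intro P.genideal_self[THEN subsetD]) auto
  moreover have "J +>\<^bsub>P\<^esub> (S.indexed_var j [^]\<^bsub>P\<^esub> p) = J +>\<^bsub>P\<^esub> S.indexed_const (zs ! j)"
    using calculation assms unfolding gen_def
    by (subst P.quotient_eq_iff_same_a_r_cos[OF J_ideal, symmetric]) (auto intro!: P.nat_pow_closed var_closed const_closed simp del: S.poly_ring_simps)
  ultimately have "cls (S.indexed_var j [^]\<^bsub>P\<^esub> p) = incl (zs ! j)"
    by (simp add: root_class_def root_incl_def)
  then show ?thesis
    using assms by (simp add: zs'_nth cls.ring.hom_nat_pow var_closed del: S.poly_ring_simps)
qed

lemma hom_eq:
  assumes "h1 \<in> ring_hom S' D" "h2 \<in> ring_hom S' D"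
    and "\<And>a. a \<in> carrier S \<Longrightarrow> h1 (incl a) = h2 (incl a)"
    and "\<And>j. j < n \<Longrightarrow> h1 (zs' ! j) = h2 (zs' ! j)" and "a \<in> carrier S'"
  shows "h1 a = h2 a"
proof -
  obtain f where f: "f \<in> carrier P" "a = cls f" using assms(5) by (rule cls_surj)
  have "(h1 \<circ> cls) f = (h2 \<circ> cls) f"
    by (rule poly_ring_hom_eq[OF S.is_cring ring_hom_trans[OF cls_hom assms(1)]
          ring_hom_trans[OF cls_hom assms(2)]])
      (use assms(3-4) f in \<open>auto simp: root_incl_def zs'_nth\<close>)
  then show ?thesis using f by simp
qed

lemma adjoin_induct [consumes 1, case_names incl root add mult]:
  assumes "a \<in> carrier S'"
    and incl: "\<And>a. a \<in> carrier S \<Longrightarrow> Q (incl a)" and root: "\<And>j. j < n \<Longrightarrow> Q (zs' ! j)"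
    and add: "\<And>a b. a \<in> carrier S' \<Longrightarrow> b \<in> carrier S' \<Longrightarrow> Q a \<Longrightarrow> Q b \<Longrightarrow> Q (a \<oplus>\<^bsub>S'\<^esub> b)"
    and mult: "\<And>a b. a \<in> carrier S' \<Longrightarrow> b \<in> carrier S' \<Longrightarrow> Q a \<Longrightarrow> Q b \<Longrightarrow> Q (a \<otimes>\<^bsub>S'\<^esub> b)"
  shows "Q a"
proof -
  obtain f where f: "f \<in> carrier P" "a = cls f" using assms(1) by (rule cls_surj)
  from f(1) have "f \<in> S.pset {..<n}" by simp
  then have "Q (cls f)"
  proof (induction rule: S.indexed_pset.induct)
    case (indexed_const k)
    then show ?case using incl[of k] by (simp add: root_incl_def)
  next
    case (indexed_padd f g)
    then show ?case using add[of "cls f" "cls g"] cls.hom_closed cls.hom_add[of f g]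
      by (simp add: S.indexed_padd_def)
  next
    case (indexed_pmult f j)
    then show ?case
      using mult[of "cls (S.indexed_var j)" "cls f"] root[of j] cls.hom_closed
        cls.hom_mult[of "S.indexed_var j" f]
      by (simp add: S.indexed_var_mult S.pset_coeff S.pset_var zs'_nth)
  qed
  then show ?thesis using f by simp
qed

text \<open>The map out of \<open>S'\<close> given by the universal property of adjoining roots. It
  evaluates the stored representative, as \<open>stage_map\<close> does; that any other
  representative gives the same value is \<open>lift_cls\<close>.\<close>

definition "lift D h d a = poly_eval S D h d (step_poly a)"

context
  fixes D :: "('d, 'e) ring_scheme" and h d
  assumes D: "cring D" and h: "h \<in> ring_hom S D" and d: "\<And>j. j < n \<Longrightarrow> d j \<in> carrier D"
    and pow: "\<And>j. j < n \<Longrightarrow> d j [^]\<^bsub>D\<^esub> p = h (zs ! j)"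
begin

interpretation E: poly_evaluation S D h "{..<n}" d
  using D h d S.is_cring
  by (simp add: poly_evaluation_def poly_evaluation_axioms_def ring_hom_cring_def ring_hom_cring_axioms_def)

interpretation V: ring_hom_cring P D E.ev by (rule E.ev_hom_cring)

text \<open>The hypothesis on the \<open>p\<close>-th power of \<open>d j\<close> says that
  evaluation kills every generator of \<open>J\<close>, hence all of \<open>J\<close>; and the
  stored representative of \<open>cls f\<close> differs from \<open>f\<close> by an element of
  \<open>J\<close>.\<close>

lemma lift_cls:
  assumes "f \<in> carrier P" shows "lift D h d (cls f) = E.ev f"
proof -
  have "E.ev (gen j) = \<zero>\<^bsub>D\<^esub>" if "j < n" for j
    using that d pow h[THEN ring_hom_closed]
    by (simp add: gen_def P.minus_eq V.ring.hom_nat_pow var_closed const_closed E.S.r_neg del: S.poly_ring_simps)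
  then have "{gen j | j. j < n} \<subseteq> a_kernel P D E.ev"
    unfolding a_kernel_def' using gen_closed by blast
  then have "J \<subseteq> a_kernel P D E.ev"
    unfolding J_eq by (intro P.genideal_minimal V.ring.kernel_is_ideal)
  then have J0: "E.ev j = \<zero>\<^bsub>D\<^esub>" if "j \<in> J" for j
    using that unfolding a_kernel_def' by blast
  obtain j where j: "j \<in> J" "step_poly (cls f) = j \<oplus>\<^bsub>P\<^esub> f"
    using step_poly_cls[OF assms] unfolding a_r_coset_def' by blast
  then show ?thesis
    using assms J0[of j] J.Icarr[of j] V.hom_add[of j f] V.hom_closed[of f]
    by (simp only: lift_def E.S.l_zero)
qed

lemma lift_hom: "lift D h d \<in> ring_hom S' D"
proof (rule ring_hom_memI)
  fix a b assume "a \<in> carrier S'" "b \<in> carrier S'"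
  then obtain f g where fg: "f \<in> carrier P" "a = cls f" "g \<in> carrier P" "b = cls g"
    by (metis cls_surj)
  show "lift D h d a \<in> carrier D" using fg by (simp only: lift_cls V.hom_closed)
  show "lift D h d (a \<otimes>\<^bsub>S'\<^esub> b) = lift D h d a \<otimes>\<^bsub>D\<^esub> lift D h d b"
    using fg by (simp only: cls.hom_mult[symmetric] lift_cls V.hom_mult P.m_closed)
  show "lift D h d (a \<oplus>\<^bsub>S'\<^esub> b) = lift D h d a \<oplus>\<^bsub>D\<^esub> lift D h d b"
    using fg by (simp only: cls.hom_add[symmetric] lift_cls V.hom_add P.a_closed)
next
  show "lift D h d \<one>\<^bsub>S'\<^esub> = \<one>\<^bsub>D\<^esub>"
    using lift_cls[OF P.one_closed] by (simp only: cls.hom_one V.hom_one)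
qed

lemma lift_incl: "a \<in> carrier S \<Longrightarrow> lift D h d (incl a) = h a"
  by (simp add: root_incl_def lift_cls const_closed del: S.poly_ring_simps)

lemma lift_root: "j < n \<Longrightarrow> lift D h d (zs' ! j) = d j"
  by (simp add: zs'_nth lift_cls var_closed del: S.poly_ring_simps)

end

text \<open>With the Frobenius as \<open>h\<close> and \<open>zs ! j\<close> itself as
  \<open>d j\<close>, the power condition of \<open>lift_hom\<close> becomes an identity. This is
  the transition map from \<open>S'\<close> down to \<open>S\<close>.\<close>

definition "frob_lift = lift S (\<lambda>a. a [^]\<^bsub>S\<^esub> p) (\<lambda>j. zs ! j)"

lemma frob_lift_hom: "frob_lift \<in> ring_hom S' S"
  unfolding frob_lift_def by (intro lift_hom S.is_cring S.frobenius_hom prime char) auto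

lemma frob_lift_incl: "a \<in> carrier S \<Longrightarrow> frob_lift (incl a) = a [^]\<^bsub>S\<^esub> p"
  unfolding frob_lift_def by (subst lift_incl) (auto intro: S.is_cring S.frobenius_hom prime char)

lemma frob_lift_root: "j < n \<Longrightarrow> frob_lift (zs' ! j) = zs ! j"
  unfolding frob_lift_def by (subst lift_root) (auto intro: S.is_cring S.frobenius_hom prime char)

text \<open>Both sides are homomorphisms on \<open>S'\<close> that agree on \<open>incl a\<close>
  and on the roots, whose \<open>p\<close>-th powers are \<open>incl (zs ! j)\<close>. This identity
  drives both the surjectivity of the transition maps and the nilpotence of \<tau>.\<close>

lemma incl_frob_lift:
  assumes "a \<in> carrier S'" shows "incl (frob_lift a) = a [^]\<^bsub>S'\<^esub> p"
proof -
  interpret i: ring_hom_cring S S' incl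
    by (intro ring_hom_cring.intro ring_hom_cring_axioms.intro incl_hom adjoin_cring S.is_cring)
  have "(incl \<circ> frob_lift) a = a [^]\<^bsub>S'\<^esub> p"
    by (rule hom_eq[OF ring_hom_trans[OF frob_lift_hom incl_hom] S'.frobenius_hom[OF prime char']])
      (use assms in \<open>auto simp: frob_lift_incl frob_lift_root zs'_pow i.ring.hom_nat_pow\<close>)
  then show ?thesis by simp
qed

end

section \<open>The tower\<close>

text \<open>The image of a homomorphism is a subring, so surjectivity in \<open>phi_surj\<close> and
  \<open>E_surj\<close> can be checked on generators.\<close>

lemma (in ring_hom_cring) image_closed:
  shows image_one: "\<one>\<^bsub>S\<^esub> \<in> h ` carrier R"
    and image_a_inv: "a \<in> h ` carrier R \<Longrightarrow> \<ominus>\<^bsub>S\<^esub> a \<in> h ` carrier R"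
    and image_add: "a \<in> h ` carrier R \<Longrightarrow> b \<in> h ` carrier R \<Longrightarrow> a \<oplus>\<^bsub>S\<^esub> b \<in> h ` carrier R"
    and image_mult: "a \<in> h ` carrier R \<Longrightarrow> b \<in> h ` carrier R \<Longrightarrow> a \<otimes>\<^bsub>S\<^esub> b \<in> h ` carrier R"
  by (metis imageI hom_one R.one_closed, auto simp: image_iff,
      metis hom_a_inv R.a_inv_closed, metis hom_add R.a_closed, metis hom_mult R.m_closed)

locale gabber_tower =
  fixes p :: nat and R :: "('a, 'b) ring_scheme" and xs :: "'a list"
  assumes prime: "Factorial_Ring.prime p" and cring: "cring R" and char: "has_char p R"
    and xs_closed: "set xs \<subseteq> carrier R"
begin

abbreviation "A \<equiv> stage_ring p R xs"
abbreviation "z \<equiv> stage_tuple p R xs"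
abbreviation "\<phi> \<equiv> stage_map p R xs"
abbreviation "\<iota> i \<equiv> root_incl p (A i) (z i)"
abbreviation "G \<equiv> gabber_ring p R xs"

lemma stage_0: "A 0 = image_ring Base R" "z 0 = map Base xs"
  by (simp_all add: stage_ring_def stage_tuple_def)

lemma stage_Suc: "A (Suc i) = adjoin_roots p (A i) (z i)" "z (Suc i) = adjoined_roots p (A i) (z i)"
  by (simp_all add: stage_ring_def stage_tuple_def split_beta)

lemma Base_iso: "Base \<in> ring_iso R (A 0)"
  unfolding stage_0 by (rule inj_imp_image_ring_iso) (simp add: inj_on_def)

lemma Base_hom: "Base \<in> ring_hom R (A 0)"
  using Base_iso by (simp add: ring_iso_def)

lemma carrier_stage_0: "carrier (A 0) = Base ` carrier R"
  by (simp add: stage_0 image_ring_carrier)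

lemma root_adjunction_stage: "root_adjunction (A i) p (z i)"
proof (induction i)
  case 0
  have c: "cring (A 0)"
    unfolding stage_0 by (rule cring.image_ring_cring[OF cring]) (simp add: inj_on_def)
  show ?case
    using prime c has_char_hom[OF char Base_hom cring c] xs_closed
    by (auto simp: root_adjunction_def root_adjunction_axioms_def carrier_stage_0 stage_0(2))
next
  case (Suc i)
  then interpret root_adjunction "A i" p "z i" .
  show ?case
    unfolding stage_Suc root_adjunction_def root_adjunction_axioms_def
    using adjoin_cring prime char' zs'_closed by blast
qed

sublocale stage: root_adjunction "A i" p "z i" for i
  by (rule root_adjunction_stage)

lemma length_z [simp]: "length (z i) = length xs"
  by (induction i) (simp_all add: stage_0 stage_Suc)

lemma stage_cring: "cring (A i)"
  by (rule stage.S.is_cring)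

lemma z_closed: "j < length xs \<Longrightarrow> z i ! j \<in> carrier (A i)"
  by simp

lemma incl_hom: "\<iota> i \<in> ring_hom (A i) (A (Suc i))"
  unfolding stage_Suc by (rule stage.incl_hom)

lemma phi_eq: "\<phi> i = stage.frob_lift i"
  by (rule ext) (simp add: stage_map_def stage.frob_lift_def stage.lift_def poly_eval_def Let_def)

lemma phi_hom: "\<phi> i \<in> ring_hom (A (Suc i)) (A i)"
  unfolding stage_Suc phi_eq by (rule stage.frob_lift_hom)

lemma phi_incl: "a \<in> carrier (A i) \<Longrightarrow> \<phi> i (\<iota> i a) = a [^]\<^bsub>A i\<^esub> p"
  unfolding phi_eq by (rule stage.frob_lift_incl)

lemma incl_phi: "a \<in> carrier (A (Suc i)) \<Longrightarrow> \<iota> i (\<phi> i a) = a [^]\<^bsub>A (Suc i)\<^esub> p"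
  unfolding phi_eq stage_Suc by (rule stage.incl_frob_lift)

lemma phi_z: "j < length xs \<Longrightarrow> \<phi> i (z (Suc i) ! j) = z i ! j"
  unfolding phi_eq stage_Suc by (rule stage.frob_lift_root) simp

lemma z_pow: "j < length xs \<Longrightarrow> z (Suc i) ! j [^]\<^bsub>A (Suc i)\<^esub> p = \<iota> i (z i ! j)"
  unfolding stage_Suc by (rule stage.zs'_pow) simp

lemma stage_hom_eq:
  assumes "h1 \<in> ring_hom (A (Suc i)) D" "h2 \<in> ring_hom (A (Suc i)) D"
    and "\<And>a. a \<in> carrier (A i) \<Longrightarrow> h1 (\<iota> i a) = h2 (\<iota> i a)"
    and "\<And>j. j < length xs \<Longrightarrow> h1 (z (Suc i) ! j) = h2 (z (Suc i) ! j)" and "a \<in> carrier (A (Suc i))"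
  shows "h1 a = h2 a"
  using assms unfolding stage_Suc by (intro stage.hom_eq[of h1 i D h2 a]) simp_all

lemma stage_induct [consumes 1, case_names incl root add mult]:
  assumes "a \<in> carrier (A (Suc i))"
    and "\<And>a. a \<in> carrier (A i) \<Longrightarrow> Q (\<iota> i a)" and "\<And>j. j < length xs \<Longrightarrow> Q (z (Suc i) ! j)"
    and "\<And>a b. a \<in> carrier (A (Suc i)) \<Longrightarrow> b \<in> carrier (A (Suc i)) \<Longrightarrow> Q a \<Longrightarrow> Q b \<Longrightarrow> Q (a \<oplus>\<^bsub>A (Suc i)\<^esub> b)"
    and "\<And>a b. a \<in> carrier (A (Suc i)) \<Longrightarrow> b \<in> carrier (A (Suc i)) \<Longrightarrow> Q a \<Longrightarrow> Q b \<Longrightarrow> Q (a \<otimes>\<^bsub>A (Suc i)\<^esub> b)"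
  shows "Q a"
  using assms unfolding stage_Suc by (intro stage.adjoin_induct[of a i Q]) simp_all

lemma stage_lift:
  assumes "cring D" "h \<in> ring_hom (A i) D" "\<And>j. j < length xs \<Longrightarrow> d j \<in> carrier D"
    and "\<And>j. j < length xs \<Longrightarrow> d j [^]\<^bsub>D\<^esub> p = h (z i ! j)"
  obtains g where "g \<in> ring_hom (A (Suc i)) D" "\<And>a. a \<in> carrier (A i) \<Longrightarrow> g (\<iota> i a) = h a"
    "\<And>j. j < length xs \<Longrightarrow> g (z (Suc i) ! j) = d j"
proof
  show "stage.lift i D h d \<in> ring_hom (A (Suc i)) D"
    unfolding stage_Suc using assms by (intro stage.lift_hom) simp_all
  show "stage.lift i D h d (\<iota> i a) = h a" if "a \<in> carrier (A i)" for a
    using assms that by (intro stage.lift_incl) simp_all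
  show "stage.lift i D h d (z (Suc i) ! j) = d j" if "j < length xs" for j
    unfolding stage_Suc using assms that by (intro stage.lift_root) simp_all
qed

section \<open>The inverse limit\<close>

lemma gabber_ring_simps [simp]:
  "s \<otimes>\<^bsub>G\<^esub> t = (\<lambda>i. s i \<otimes>\<^bsub>A i\<^esub> t i)" "s \<oplus>\<^bsub>G\<^esub> t = (\<lambda>i. s i \<oplus>\<^bsub>A i\<^esub> t i)"
  "\<one>\<^bsub>G\<^esub> = (\<lambda>i. \<one>\<^bsub>A i\<^esub>)" "\<zero>\<^bsub>G\<^esub> = (\<lambda>i. \<zero>\<^bsub>A i\<^esub>)"
  by (simp_all add: gabber_ring_def)

lemma gabber_carrier: "s \<in> carrier G \<longleftrightarrow> (\<forall>i. s i \<in> carrier (A i) \<and> \<phi> i (s (Suc i)) = s i)"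
  by (simp add: gabber_ring_def)

lemma gabber_closed: "s \<in> carrier G \<Longrightarrow> s i \<in> carrier (A i)"
  by (simp add: gabber_carrier)

lemma gabber_phi: "s \<in> carrier G \<Longrightarrow> \<phi> i (s (Suc i)) = s i"
  by (simp add: gabber_carrier)

lemma phi_cring_hom: "ring_hom_cring (A (Suc i)) (A i) (\<phi> i)"
  by (intro ring_hom_cring.intro ring_hom_cring_axioms.intro stage_cring phi_hom)

lemma incl_cring_hom: "ring_hom_cring (A i) (A (Suc i)) (\<iota> i)"
  by (intro ring_hom_cring.intro ring_hom_cring_axioms.intro stage_cring incl_hom)

lemma gabber_cring: "cring G"
proof (rule cringI)
  interpret phi: ring_hom_cring "A (Suc i)" "A i" "\<phi> i" for i by (rule phi_cring_hom)
  show "abelian_group G"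
  proof (rule abelian_groupI)
    fix s assume "s \<in> carrier G"
    then show "\<exists>t\<in>carrier G. t \<oplus>\<^bsub>G\<^esub> s = \<zero>\<^bsub>G\<^esub>"
      by (intro bexI[of _ "\<lambda>i. \<ominus>\<^bsub>A i\<^esub> s i"]) (auto simp: gabber_carrier stage.S.l_neg)
  qed (auto simp: gabber_carrier stage.S.a_ac)
  show "comm_monoid G"
    by (rule comm_monoidI) (auto simp: gabber_carrier stage.S.m_ac)
qed (auto simp: gabber_carrier stage.S.l_distr)

sublocale G: cring G by (rule gabber_cring)

lemma gabber_finsum: "finite K \<Longrightarrow> F \<in> K \<rightarrow> carrier G \<Longrightarrow> finsum G F K i = (\<Oplus>\<^bsub>A i\<^esub>k\<in>K. F k i)"
proof (induction K rule: finite_induct)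
  case (insert k K)
  then show ?case by (subst G.finsum_insert) (auto simp: gabber_closed Pi_def)
qed simp

text \<open>At stage 0 the image contains the \<open>p\<close>-th powers of \<open>R\<close>, coming
  from constants, and the entries of \<open>xs\<close>, coming from the roots; these generate
  \<open>R\<close>. At a higher stage it contains the roots of that stage and, by induction,
  everything included from the stage below.\<close>

lemma phi_surj:
  assumes gen: "p_generating p R xs" and "a \<in> carrier (A i)"
  obtains b where "b \<in> carrier (A (Suc i))" "\<phi> i b = a"
proof -
  have "a \<in> \<phi> i ` carrier (A (Suc i))"
    using assms(2)
  proof (induction i arbitrary: a)
    case 0
    interpret phi: ring_hom_cring "A (Suc 0)" "A 0" "\<phi> 0" by (rule phi_cring_hom)
    interpret incl: ring_hom_cring "A 0" "A (Suc 0)" "\<iota> 0" by (rule incl_cring_hom)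
    interpret R: cring R by (rule cring)
    interpret Base: ring_hom_cring R "A 0" Base
      by (intro ring_hom_cring.intro ring_hom_cring_axioms.intro stage_cring Base_hom cring)
    have "pth_powers p R \<union> set xs \<subseteq> carrier R" using xs_closed by (auto simp: pth_powers_def)
    note gen_closed = R.generate_ring_in_carrier[OF this]
    have "Base r \<in> \<phi> 0 ` carrier (A (Suc 0))" if "r \<in> generate_ring R (pth_powers p R \<union> set xs)" for r
      using that
    proof (induction rule: generate_ring.induct)
      case one
      then show ?case using phi.image_one by simp
    next
      case (incl r)
      then consider r' where "r' \<in> carrier R" "r = r' [^]\<^bsub>R\<^esub> p" | j where "j < length xs" "r = xs ! j"
        by (auto simp: pth_powers_def in_set_conv_nth)
      then show ?case
      proof cases
        case 1
        then have "Base r = \<phi> 0 (\<iota> 0 (Base r'))"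
          by (simp add: phi_incl Base.ring.hom_nat_pow)
        then show ?thesis using 1 by blast
      next
        case 2
        then have "Base r = \<phi> 0 (z (Suc 0) ! j)" by (simp add: phi_z stage_0)
        then show ?thesis using 2 z_closed by blast
      qed
    next
      case (a_inv r)
      then show ?case by (simp only: Base.hom_a_inv[OF gen_closed] phi.image_a_inv)
    next
      case (eng_add r s)
      then show ?case by (simp only: Base.hom_add[OF gen_closed gen_closed] phi.image_add)
    next
      case (eng_mult r s)
      then show ?case by (simp only: Base.hom_mult[OF gen_closed gen_closed] phi.image_mult)
    qed
    then show ?case using 0 gen by (auto simp: carrier_stage_0 p_generating_def)
  next
    case (Suc i)
    interpret phi: ring_hom_cring "A (Suc (Suc i))" "A (Suc i)" "\<phi> (Suc i)" by (rule phi_cring_hom)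
    from Suc.prems show ?case
    proof (induction rule: stage_induct)
      case (incl a)
      then obtain b where b: "b \<in> carrier (A (Suc i))" "a = \<phi> i b" using Suc.IH by blast
      \<comment> \<open>Both sides are the \<open>p\<close>-th power of \<open>b\<close>: inclusion
        after transition and transition after inclusion are each the Frobenius.\<close>
      then have "\<iota> i a = \<phi> (Suc i) (\<iota> (Suc i) b)" by (simp add: incl_phi phi_incl)
      then show ?case using b ring_hom_closed[OF incl_hom] by blast
    next
      case (root j)
      then show ?case by (intro image_eqI[of _ _ "z (Suc (Suc i)) ! j"]) (simp_all only: phi_z z_closed)
    next
      case (add a b)
      then show ?case by (simp add: phi.image_add)
    next
      case (mult a b)
      then show ?case by (simp add: phi.image_mult)
    qed
  qed
  then show thesis using that by blast
qed

lemma gabber_proj_surj: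
  assumes "p_generating p R xs" "a \<in> carrier (A 0)"
  obtains s where "s \<in> carrier G" "s 0 = a"
proof -
  have "\<exists>s. s 0 = a \<and> (\<forall>i. s i \<in> carrier (A i) \<and> \<phi> i (s (Suc i)) = s i)"
  proof -
    have "\<exists>s. \<forall>i. (s i \<in> carrier (A i) \<and> (i = 0 \<longrightarrow> s i = a)) \<and> \<phi> i (s (Suc i)) = s i"
      by (rule dependent_nat_choice) (use assms phi_surj in \<open>metis nat.distinct(1)\<close>)+
    then show ?thesis by metis
  qed
  then show thesis using that by (auto simp: gabber_carrier)
qed

text \<open>The transition maps make each component determine all lower ones, so an equality may be
  tested at an arbitrarily high stage.\<close>

lemma gabber_eq_below:
  assumes "s \<in> carrier G" "t \<in> carrier G" "s k = t k" "i \<le> k"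
  shows "s i = t i"
  using assms(4)
proof (induction rule: inc_induct)
  case (step i)
  then show ?case using gabber_phi[OF assms(1), of i] gabber_phi[OF assms(2), of i] by simp
qed (rule assms(3))

text \<open>The limit depends only on a tail of the system: missing lower components are filled in
  by applying the transition maps downwards. In \<open>\<Phi>_surj\<close> coefficients are known
  only from some stage on.\<close>

lemma gabber_extend:
  assumes "\<And>i. N \<le> i \<Longrightarrow> g i \<in> carrier (A i) \<and> \<phi> i (g (Suc i)) = g i"
  obtains s where "s \<in> carrier G" "\<And>i. N \<le> i \<Longrightarrow> s i = g i"
proof -
  have "\<exists>s\<in>carrier G. \<forall>i\<ge>N. s i = g i"
    using assms
  proof (induction N arbitrary: g)
    case 0
    then show ?case by (intro bexI[of _ g]) (auto simp: gabber_carrier)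
  next
    case (Suc N)
    define g' where "g' = g(N := \<phi> N (g (Suc N)))"
    have "g' i \<in> carrier (A i) \<and> \<phi> i (g' (Suc i)) = g' i" if "N \<le> i" for i
      using that Suc.prems[of i] Suc.prems[of "Suc N"] ring_hom_closed[OF phi_hom]
      by (cases "i = N") (auto simp: g'_def)
    then obtain s where "s \<in> carrier G" "\<forall>i\<ge>N. s i = g' i" using Suc.IH by blast
    then show ?case by (intro bexI[of _ s]) (auto simp: g'_def)
  qed
  then show thesis using that by blast
qed

end

section \<open>Truncation\<close>

text \<open>The homomorphism theorem for a ring \<open>B\<close> known only as an image of
  \<open>P\<close>, which is how evaluation presents the stages of the second tower.\<close>

lemma hom_factor:
  assumes "cring P" "cring B" "cring Q" and h: "h \<in> ring_hom P B" and g: "g \<in> ring_hom P Q"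
    and surj: "h ` carrier P = carrier B"
    and ker: "\<And>f. f \<in> carrier P \<Longrightarrow> h f = \<zero>\<^bsub>B\<^esub> \<Longrightarrow> g f = \<zero>\<^bsub>Q\<^esub>"
  obtains k where "k \<in> ring_hom B Q" "\<And>f. f \<in> carrier P \<Longrightarrow> k (h f) = g f"
proof -
  interpret h: ring_hom_cring P B h
    using assms by (simp add: ring_hom_cring_def ring_hom_cring_axioms_def)
  interpret g: ring_hom_cring P Q g
    using assms by (simp add: ring_hom_cring_def ring_hom_cring_axioms_def)
  define k where "k b = g (SOME f. f \<in> carrier P \<and> h f = b)" for b
  have kh: "k (h f) = g f" if f: "f \<in> carrier P" for f
  proof -
    define f' where "f' = (SOME f'. f' \<in> carrier P \<and> h f' = h f)"
    have f': "f' \<in> carrier P" "h f' = h f"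
      using someI[of "\<lambda>f'. f' \<in> carrier P \<and> h f' = h f" f] f unfolding f'_def by blast+
    \<comment> \<open>Two preimages of the same element differ by an element of the kernel of
      \<open>h\<close>, on which \<open>g\<close> vanishes; so the choice in \<open>k\<close> does
      not matter.\<close>
    have "h (f' \<ominus>\<^bsub>P\<^esub> f) = \<zero>\<^bsub>B\<^esub>"
      using f f' by (simp add: h.R.minus_eq h.S.r_neg)
    then have "g (f' \<ominus>\<^bsub>P\<^esub> f) = \<zero>\<^bsub>Q\<^esub>" using f f' by (intro ker h.R.minus_closed)
    then have "g f' \<ominus>\<^bsub>Q\<^esub> g f = \<zero>\<^bsub>Q\<^esub>"
      using f f' by (simp add: h.R.minus_eq g.S.minus_eq)
    then show ?thesis using f f' by (simp add: k_def f'_def[symmetric])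
  qed
  have "k \<in> ring_hom B Q"
  proof (rule ring_hom_memI)
    fix a b assume "a \<in> carrier B" "b \<in> carrier B"
    then obtain e f where ef: "e \<in> carrier P" "a = h e" "f \<in> carrier P" "b = h f"
      using surj by blast
    show "k a \<in> carrier Q" using ef by (simp add: kh)
    show "k (a \<otimes>\<^bsub>B\<^esub> b) = k a \<otimes>\<^bsub>Q\<^esub> k b"
      using ef kh[of "e \<otimes>\<^bsub>P\<^esub> f"] by (simp add: kh)
    show "k (a \<oplus>\<^bsub>B\<^esub> b) = k a \<oplus>\<^bsub>Q\<^esub> k b"
      using ef kh[of "e \<oplus>\<^bsub>P\<^esub> f"] by (simp add: kh)
  next
    show "k \<one>\<^bsub>B\<^esub> = \<one>\<^bsub>Q\<^esub>" using kh[OF h.R.one_closed] by simp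
  qed
  then show thesis using kh that by blast
qed

definition small_monomial :: "nat \<Rightarrow> 'c multiset \<Rightarrow> bool" where
  "small_monomial q M \<longleftrightarrow> (\<forall>j. count M j < q)"

lemma small_monomial_submultiset: "small_monomial q M \<Longrightarrow> N \<subseteq># M \<Longrightarrow> small_monomial q N"
  unfolding small_monomial_def subseteq_mset_def using le_less_trans by blast

lemma small_monomial_mono: "small_monomial q M \<Longrightarrow> q \<le> q' \<Longrightarrow> small_monomial q' M"
  unfolding small_monomial_def using less_le_trans by blast

text \<open>The situation at stage 0, where the truncation exponent is \<open>p ^ 0\<close>. It is
  the reason why the projection to \<open>R\<close> sees only the constant coefficient.\<close>

lemma small_monomial_1: "small_monomial (Suc 0) M \<longleftrightarrow> M = {#}"
  by (auto simp: small_monomial_def multiset_eq_iff)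

lemma finite_small_monomials:
  assumes "finite I" shows "finite {M. set_mset M \<subseteq> I \<and> small_monomial q M}"
proof (rule finite_subset)
  show "finite {M. M \<subseteq># (\<Sum>j\<in>I. replicate_mset q j)}" by (rule finite_submultisets)
  show "{M. set_mset M \<subseteq> I \<and> small_monomial q M} \<subseteq> {M. M \<subseteq># (\<Sum>j\<in>I. replicate_mset q j)}"
  proof
    fix M assume "M \<in> {M. set_mset M \<subseteq> I \<and> small_monomial q M}"
    then have M: "set_mset M \<subseteq> I" "\<And>j. count M j < q" by (auto simp: small_monomial_def)
    have "count M j \<le> count (\<Sum>j\<in>I. replicate_mset q j) j" for j
    proof (cases "j \<in> I")
      case True
      then have "count (\<Sum>j\<in>I. replicate_mset q j) j = q" using assms by (simp add: count_sum)
      then show ?thesis using M(2)[of j] by simp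
    next
      case False
      then have "j \<notin># M" using M by blast
      then show ?thesis by (simp add: not_in_iff)
    qed
    then show "M \<in> {M. M \<subseteq># (\<Sum>j\<in>I. replicate_mset q j)}" by (simp add: subseteq_mset_def)
  qed
qed

text \<open>For positive \<open>q\<close> this is the ideal generated by the \<open>q\<close>-th
  powers of the variables. Described by coefficients, congruence modulo the ideal is equality of the
  coefficients at small monomials.\<close>

definition trunc_ideal :: "('a, 'b) ring_scheme \<Rightarrow> nat \<Rightarrow> 'c set \<Rightarrow> ('c multiset \<Rightarrow> 'a) set" where
  "trunc_ideal R q I = {f \<in> carrier (indexed_poly_ring R I). \<forall>M. small_monomial q M \<longrightarrow> f M = \<zero>\<^bsub>R\<^esub>}"

definition trunc_series :: "('a, 'b) ring_scheme \<Rightarrow> nat \<Rightarrow> ('c multiset \<Rightarrow> 'a) \<Rightarrow> 'c multiset \<Rightarrow> 'a" where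
  "trunc_series R q f = (\<lambda>M. if small_monomial q M then f M else \<zero>\<^bsub>R\<^esub>)"

context cring
begin

lemma poly_minus:
  assumes "f \<in> pset I" "g \<in> pset I"
  shows "f \<ominus>\<^bsub>indexed_poly_ring R I\<^esub> g = (\<lambda>M. f M \<ominus> g M)"
proof -
  interpret P: cring "indexed_poly_ring R I" by (rule indexed_poly_ring_cring)
  have "\<ominus>\<^bsub>indexed_poly_ring R I\<^esub> g = (\<lambda>M. \<ominus> \<one> \<otimes> g M)"
    using assms pset_smult[OF assms(2), of "\<ominus> \<one>"] pset_coeff[OF assms(2)]
    by (intro P.minus_equality) (auto simp: l_minus l_neg)
  then show ?thesis
    using pset_coeff[OF assms(2)] by (simp add: P.minus_eq minus_eq l_minus)
qed

text \<open>Submultisets of a small monomial are small, so every summand of the product's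
  coefficient at a small monomial contains a vanishing coefficient of \<open>f\<close>.\<close>

lemma trunc_ideal_ideal: "ideal (trunc_ideal R q I) (indexed_poly_ring R I)"
proof -
  interpret P: cring "indexed_poly_ring R I" by (rule indexed_poly_ring_cring)
  have mult: "series_mult R g f \<in> trunc_ideal R q I" if "f \<in> trunc_ideal R q I" "g \<in> pset I" for f g
  proof -
    have f: "f \<in> pset I" "\<And>M. small_monomial q M \<Longrightarrow> f M = \<zero>"
      using that by (auto simp: trunc_ideal_def)
    have "series_mult R g f M = \<zero>" if "small_monomial q M" for M
      using that f pset_coeff[OF f(1)] pset_coeff[OF \<open>g \<in> pset I\<close>] small_monomial_submultiset[OF that]
      by (intro series_mult_support) (metis diff_subset_eq_self)+
    then show ?thesis using f that by (simp add: trunc_ideal_def pset_mult)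
  qed
  show ?thesis
  proof (rule idealI)
    show "ring (indexed_poly_ring R I)" by (rule P.ring_axioms)
    have "\<zero>\<^bsub>indexed_poly_ring R I\<^esub> \<in> trunc_ideal R q I"
      using P.zero_closed by (simp add: trunc_ideal_def)
    moreover have "\<ominus>\<^bsub>indexed_poly_ring R I\<^esub> f \<in> trunc_ideal R q I" if "f \<in> trunc_ideal R q I" for f
    proof -
      have f: "f \<in> pset I" using that by (simp add: trunc_ideal_def)
      have "\<ominus>\<^bsub>indexed_poly_ring R I\<^esub> f = \<zero>\<^bsub>indexed_poly_ring R I\<^esub> \<ominus>\<^bsub>indexed_poly_ring R I\<^esub> f"
        using f P.a_inv_closed[of f] P.l_zero[of "\<ominus>\<^bsub>indexed_poly_ring R I\<^esub> f"] by (simp only: P.minus_eq poly_ring_simps(1))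
      also have "\<dots> = (\<lambda>M. \<zero> \<ominus> f M)"
        using poly_minus[of "\<lambda>M. \<zero>" I f] P.zero_closed f by simp
      finally show ?thesis
        using that P.a_inv_closed[of f] by (simp add: trunc_ideal_def minus_eq)
    qed
    ultimately show "subgroup (trunc_ideal R q I) (add_monoid (indexed_poly_ring R I))"
      using P.a_closed
      by (intro P.add.subgroupI) (auto simp: trunc_ideal_def)
    fix f g assume *: "f \<in> trunc_ideal R q I" "g \<in> carrier (indexed_poly_ring R I)"
    then show "g \<otimes>\<^bsub>indexed_poly_ring R I\<^esub> f \<in> trunc_ideal R q I" by (simp add: mult)
    then show "f \<otimes>\<^bsub>indexed_poly_ring R I\<^esub> g \<in> trunc_ideal R q I"
      using * P.m_comm[of f g] by (auto simp: trunc_ideal_def)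
  qed
qed

lemma indexed_var_pow:
  assumes "i \<in> I"
  shows "indexed_var i [^]\<^bsub>indexed_poly_ring R I\<^esub> (k::nat) = (\<lambda>M. if M = replicate_mset k i then \<one> else \<zero>)"
proof (induction k)
  case 0
  then show ?case by (simp add: indexed_const_def)
next
  case (Suc k)
  interpret P: cring "indexed_poly_ring R I" by (rule indexed_poly_ring_cring)
  have v: "indexed_var i \<in> carrier (indexed_poly_ring R I)" using assms by (simp add: pset_var)
  have "indexed_var i [^]\<^bsub>indexed_poly_ring R I\<^esub> Suc k
      = series_mult R (indexed_var i) (\<lambda>M. if M = replicate_mset k i then \<one> else \<zero>)"
    using v Suc by (simp only: P.nat_pow_Suc2 poly_ring_simps)
  also have "\<dots> = indexed_pmult (\<lambda>M. if M = replicate_mset k i then \<one> else \<zero>) i"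
    by (rule indexed_var_mult) simp
  also have "\<dots> = (\<lambda>M. if M = replicate_mset (Suc k) i then \<one> else \<zero>)"
    by (auto simp: indexed_pmult_def fun_eq_iff dest!: multi_member_split)
  finally show ?case .
qed

lemma indexed_var_pow_trunc:
  assumes "i \<in> I"
  shows "indexed_var i [^]\<^bsub>indexed_poly_ring R I\<^esub> (q::nat) \<in> trunc_ideal R q I"
proof -
  interpret P: cring "indexed_poly_ring R I" by (rule indexed_poly_ring_cring)
  have "\<not> small_monomial q (replicate_mset q i)" by (auto simp: small_monomial_def)
  moreover have "indexed_var i [^]\<^bsub>indexed_poly_ring R I\<^esub> q \<in> carrier (indexed_poly_ring R I)"
    using assms by (intro P.nat_pow_closed) (simp add: pset_var)
  ultimately show ?thesis
    unfolding trunc_ideal_def using assms by (auto simp: indexed_var_pow)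
qed

lemma trunc_series_closed:
  assumes "finite I" "f \<in> carrier (series_ring R I)"
  shows "trunc_series R q f \<in> pset I"
proof (rule psetI)
  show "trunc_series R q f \<in> carrier (series_ring R I)"
    using assms by (auto simp: trunc_series_def)
  have "{M. trunc_series R q f M \<noteq> \<zero>} \<subseteq> {M. set_mset M \<subseteq> I \<and> small_monomial q M}"
    using assms by (auto simp: trunc_series_def split: if_splits)
  then show "finite {M. trunc_series R q f M \<noteq> \<zero>}"
    using finite_small_monomials[OF assms(1)] finite_subset by blast
qed

text \<open>The convolution at a small monomial never reaches a discarded coefficient. At other
  monomials the product of the truncations may be nonzero, so truncation itself is not
  multiplicative.\<close>

lemma trunc_series_mult:
  assumes f: "\<And>M. f M \<in> carrier R" and g: "\<And>M. g M \<in> carrier R" and M: "small_monomial q M"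
  shows "series_mult R (trunc_series R q f) (trunc_series R q g) M = series_mult R f g M"
  unfolding series_mult_def
proof (rule finsum_cong')
  fix N assume "N \<in> {N. N \<subseteq># M}"
  then have "small_monomial q N" "small_monomial q (M - N)"
    using small_monomial_submultiset[OF M] by auto
  then show "trunc_series R q f N \<otimes> trunc_series R q g (M - N) = f N \<otimes> g (M - N)"
    by (simp add: trunc_series_def)
qed (use f g in auto)

end

lemma (in poly_evaluation) ev_trunc_ideal:
  assumes "f \<in> trunc_ideal R q I" "0 < q" "\<And>i. i \<in> I \<Longrightarrow> d i [^]\<^bsub>S\<^esub> q = \<zero>\<^bsub>S\<^esub>"
  shows "ev f = \<zero>\<^bsub>S\<^esub>"
proof (rule ev_eq_zero)
  show "f \<in> R.pset I" using assms by (simp add: trunc_ideal_def)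
  fix M assume M: "set_mset M \<subseteq> I"
  show "f M = \<zero> \<or> monomial M = \<zero>\<^bsub>S\<^esub>"
  proof (cases "small_monomial q M")
    case True
    then show ?thesis using assms by (simp add: trunc_ideal_def)
  next
    case False
    then obtain i where i: "q \<le> count M i" by (auto simp: small_monomial_def not_less)
    \<comment> \<open>Positivity of \<open>q\<close> puts \<open>i\<close> into \<open>M\<close>,
      hence into \<open>I\<close>, where the nilpotence is assumed.\<close>
    then have "i \<in># M" using assms(2) by (intro count_inI) simp
    then show ?thesis using monomial_eq_zero[OF M _ _ i] assms(3) M by blast
  qed
qed

text \<open>Evaluation is natural in commuting squares. Induction on the polynomial avoids a
  comparison of supports, which may shrink because \<open>k\<close> can annihilate
  coefficients.\<close>

lemma poly_eval_map:
  fixes I :: "'i set"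
  assumes "poly_evaluation R S h I d" "poly_evaluation R' S' h' I d'"
    and g: "g \<in> ring_hom S S'" and k: "k \<in> ring_hom R R'"
    and "\<And>a. a \<in> carrier R \<Longrightarrow> g (h a) = h' (k a)" "\<And>i. i \<in> I \<Longrightarrow> g (d i) = d' i"
    and "f \<in> carrier (indexed_poly_ring R I)"
  shows "(\<lambda>M. k (f M)) \<in> carrier (indexed_poly_ring R' I)"
    and "g (poly_eval R S h d f) = poly_eval R' S' h' d' (\<lambda>M. k (f M))"
proof -
  interpret X: poly_evaluation R S h I d by fact
  interpret Y: poly_evaluation R' S' h' I d' by fact
  interpret k: ring_hom_cring R R' k
    using k X.R.is_cring Y.R.is_cring by (simp add: ring_hom_cring_def ring_hom_cring_axioms_def)
  have "f \<in> X.R.pset I" using assms by simp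
  then have "(\<lambda>M. k (f M)) \<in> Y.R.pset I \<and> g (X.ev f) = Y.ev (\<lambda>M. k (f M))"
  proof (induction rule: X.R.indexed_pset.induct)
    case (indexed_const a)
    have "(\<lambda>M :: 'i multiset. k (X.R.indexed_const a M)) = Y.R.indexed_const (k a)"
      by (auto simp: X.R.indexed_const_def Y.R.indexed_const_def)
    then show ?case using indexed_const assms(5) by (simp add: Y.R.indexed_pset.indexed_const)
  next
    case (indexed_padd e f)
    have "(\<lambda>M. k (X.R.indexed_padd e f M)) = Y.R.indexed_padd (\<lambda>M. k (e M)) (\<lambda>M. k (f M))"
      using indexed_padd by (auto simp: X.R.indexed_padd_def Y.R.indexed_padd_def X.R.pset_coeff)
    then show ?case
      using indexed_padd
      by (simp add: Y.R.indexed_pset.indexed_padd X.ev_add Y.ev_add ring_hom_add[OF g] X.ev_closed)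
  next
    case (indexed_pmult f i)
    have "(\<lambda>M. k (X.R.indexed_pmult f i M)) = Y.R.indexed_pmult (\<lambda>M. k (f M)) i"
      by (auto simp: X.R.indexed_pmult_def Y.R.indexed_pmult_def)
    then show ?case
      using indexed_pmult assms(6)
      by (simp add: Y.R.indexed_pset.indexed_pmult X.ev_pmult Y.ev_pmult ring_hom_mult[OF g]
          X.ev_closed X.d_closed)
  qed
  then show "(\<lambda>M. k (f M)) \<in> carrier (indexed_poly_ring R' I)"
    and "g (poly_eval R S h d f) = poly_eval R' S' h' d' (\<lambda>M. k (f M))" by simp_all
qed

section \<open>Comparison of the towers of \<open>xs\<close> and \<open>xs @ ys\<close>\<close>

text \<open>\<open>\<alpha>\<close> maps the first tower to the second stage by stage, and
  \<open>\<eta>\<close> lifts the entries of \<open>ys\<close> to the limit. Both are parameters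
  because the theorem obtains them from recursion and choice; it is \<open>\<eta>\<close> that makes
  the isomorphism non-canonical.\<close>

locale gabber_comparison = X: gabber_tower p R xs + Y: gabber_tower p R "xs @ ys"
  for p :: nat and R :: "('a, 'b) ring_scheme" and xs ys :: "'a list" +
  fixes \<alpha> :: "nat \<Rightarrow> 'a tower \<Rightarrow> 'a tower" and \<eta> :: "nat \<Rightarrow> nat \<Rightarrow> 'a tower"
  assumes \<alpha>_hom: "\<alpha> i \<in> ring_hom (X.A i) (Y.A i)"
    and \<alpha>_0: "a \<in> carrier (X.A 0) \<Longrightarrow> \<alpha> 0 a = a"
    and \<alpha>_z: "j < length xs \<Longrightarrow> \<alpha> i (X.z i ! j) = Y.z i ! j"
    and \<alpha>_incl: "a \<in> carrier (X.A i) \<Longrightarrow> \<alpha> (Suc i) (X.\<iota> i a) = Y.\<iota> i (\<alpha> i a)"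
    and \<eta>_closed: "j < length ys \<Longrightarrow> \<eta> j \<in> carrier X.G"
    and \<eta>_0: "j < length ys \<Longrightarrow> \<eta> j 0 = Base (ys ! j)"
begin

abbreviation "m \<equiv> length ys"

definition "\<tau> i j = Y.z i ! (length xs + j) \<ominus>\<^bsub>Y.A i\<^esub> \<alpha> i (\<eta> j i)"

abbreviation "Pr i \<equiv> indexed_poly_ring (X.A i) {..<m}"
abbreviation "T i \<equiv> trunc_ideal (X.A i) (p ^ i) {..<m}"

lemma p_pos: "0 < p"
  using X.prime by (simp add: prime_gt_0_nat)

lemma \<alpha>_cring_hom: "ring_hom_cring (X.A i) (Y.A i) (\<alpha> i)"
  by (intro ring_hom_cring.intro ring_hom_cring_axioms.intro X.stage_cring Y.stage_cring \<alpha>_hom)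

lemma \<alpha>_closed: "a \<in> carrier (X.A i) \<Longrightarrow> \<alpha> i a \<in> carrier (Y.A i)"
  by (rule ring_hom_closed[OF \<alpha>_hom])

lemma \<eta>_stage: "j < m \<Longrightarrow> \<eta> j i \<in> carrier (X.A i)"
  using \<eta>_closed X.gabber_closed by blast

lemma Yz_closed: "j < m \<Longrightarrow> Y.z i ! (length xs + j) \<in> carrier (Y.A i)"
  by (rule Y.z_closed) simp

lemma \<tau>_closed: "j < m \<Longrightarrow> \<tau> i j \<in> carrier (Y.A i)"
  unfolding \<tau>_def by (intro Y.stage.S.minus_closed Yz_closed \<alpha>_closed \<eta>_stage)

lemma Yz_eq: "j < m \<Longrightarrow> Y.z i ! (length xs + j) = \<tau> i j \<oplus>\<^bsub>Y.A i\<^esub> \<alpha> i (\<eta> j i)"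
  using Yz_closed[of j i] \<alpha>_closed[OF \<eta>_stage, of j i]
  by (simp add: \<tau>_def Y.stage.S.minus_eq Y.stage.S.a_assoc Y.stage.S.l_neg)

text \<open>Of \<open>\<alpha>\<close> only compatibility with inclusions and roots is assumed;
  these generate the upper stage, so compatibility with the transition maps follows.\<close>

lemma \<phi>_\<alpha>:
  assumes "a \<in> carrier (X.A (Suc i))"
  shows "Y.\<phi> i (\<alpha> (Suc i) a) = \<alpha> i (X.\<phi> i a)"
proof -
  interpret a: ring_hom_cring "X.A k" "Y.A k" "\<alpha> k" for k by (rule \<alpha>_cring_hom)
  have "(Y.\<phi> i \<circ> \<alpha> (Suc i)) a = (\<alpha> i \<circ> X.\<phi> i) a"
    by (rule X.stage_hom_eq[of "Y.\<phi> i \<circ> \<alpha> (Suc i)" i "Y.A i" "\<alpha> i \<circ> X.\<phi> i" a,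
          OF ring_hom_trans[OF \<alpha>_hom Y.phi_hom], OF ring_hom_trans[OF X.phi_hom \<alpha>_hom], OF _ _ assms])
      (simp_all add: \<alpha>_incl \<alpha>_z X.phi_incl Y.phi_incl X.phi_z Y.phi_z a.ring.hom_nat_pow)
  then show ?thesis by simp
qed

lemma \<phi>_\<tau>:
  assumes "j < m" shows "Y.\<phi> i (\<tau> (Suc i) j) = \<tau> i j"
proof -
  interpret f: ring_hom_cring "Y.A (Suc i)" "Y.A i" "Y.\<phi> i" by (rule Y.phi_cring_hom)
  show ?thesis
    using assms Yz_closed[OF assms, of "Suc i"] \<alpha>_closed[OF \<eta>_stage[OF assms], of "Suc i"]
      X.gabber_phi[OF \<eta>_closed[OF assms], of i]
    by (simp add: \<tau>_def Y.stage.S.minus_eq Y.phi_z \<phi>_\<alpha> \<eta>_stage)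
qed

lemma \<tau>_pow_p:
  assumes "j < m" shows "\<tau> (Suc i) j [^]\<^bsub>Y.A (Suc i)\<^esub> p = Y.\<iota> i (\<tau> i j)"
  using Y.incl_phi[OF \<tau>_closed[OF assms], of i] \<phi>_\<tau>[OF assms] by simp

text \<open>At stage 0 both terms of \<open>\<tau> 0 j\<close> are \<open>Base (ys ! j)\<close>.
  Each further stage multiplies the exponent by \<open>p\<close>, since \<open>\<tau>_pow_p\<close>
  carries a \<open>p\<close>-th power down one stage.\<close>

lemma \<tau>_nilpotent:
  assumes "j < m" shows "\<tau> i j [^]\<^bsub>Y.A i\<^esub> (p ^ i) = \<zero>\<^bsub>Y.A i\<^esub>"
proof (induction i)
  case 0
  have "ys ! j \<in> carrier R" using Y.xs_closed assms by auto
  moreover have "Y.z 0 ! (length xs + j) = Base (ys ! j)"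
    using assms by (simp add: Y.stage_0 nth_append)
  ultimately show ?case
    using Yz_closed[OF assms, of 0] \<alpha>_0[OF \<eta>_stage[OF assms]] \<eta>_0[OF assms]
    by (simp add: \<tau>_def Y.stage.S.minus_eq Y.stage.S.r_neg)
next
  case (Suc i)
  interpret incl: ring_hom_cring "Y.A i" "Y.A (Suc i)" "Y.\<iota> i" by (rule Y.incl_cring_hom)
  have "\<tau> (Suc i) j [^]\<^bsub>Y.A (Suc i)\<^esub> (p ^ Suc i) = (\<tau> (Suc i) j [^]\<^bsub>Y.A (Suc i)\<^esub> p) [^]\<^bsub>Y.A (Suc i)\<^esub> (p ^ i)"
    using \<tau>_closed[OF assms] by (simp add: Y.stage.S.nat_pow_pow)
  also have "\<dots> = Y.\<iota> i (\<tau> i j [^]\<^bsub>Y.A i\<^esub> (p ^ i))"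
    using \<tau>_closed[OF assms, of i] by (simp add: \<tau>_pow_p[OF assms] incl.ring.hom_nat_pow)
  finally show ?case by (simp add: Suc)
qed

section \<open>Evaluation at the nilpotent elements\<close>

lemma poly_evaluation_\<tau>: "poly_evaluation (X.A i) (Y.A i) (\<alpha> i) {..<m} (\<tau> i)"
  using \<alpha>_cring_hom \<tau>_closed by (simp add: poly_evaluation_def poly_evaluation_axioms_def)

sublocale E: poly_evaluation "X.A i" "Y.A i" "\<alpha> i" "{..<m}" "\<tau> i" for i
  by (rule poly_evaluation_\<tau>)

abbreviation "E i \<equiv> poly_eval (X.A i) (Y.A i) (\<alpha> i) (\<tau> i)"

lemma E_cring_hom: "ring_hom_cring (Pr i) (Y.A i) (E i)"
  by (rule E.ev_hom_cring)

lemma E_trunc_ideal: "f \<in> T i \<Longrightarrow> E i f = \<zero>\<^bsub>Y.A i\<^esub>"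
  by (rule E.ev_trunc_ideal[where q = "p ^ i"]) (use p_pos \<tau>_nilpotent in auto)

lemma Pr_cring: "cring (Pr i)"
  by (rule X.stage.S.indexed_poly_ring_cring)

lemma const_closed: "a \<in> carrier (X.A i) \<Longrightarrow> ring.indexed_const (X.A i) a \<in> carrier (Pr i)"
  by (simp add: X.stage.S.indexed_pset.indexed_const)

lemma var_closed: "j < m \<Longrightarrow> ring.indexed_var (X.A i) j \<in> carrier (Pr i)"
  by (simp add: X.stage.S.pset_var)

text \<open>It suffices to reach the generators of the stage. A root for \<open>xs\<close> is a
  value of \<open>\<alpha>\<close>, and a root for \<open>ys\<close> is \<open>\<tau>\<close> plus
  such a value. Elements of the previous stage are, by induction, polynomials in the
  \<open>\<tau> i j\<close>, which the inclusion sends to \<open>p\<close>-th powers of the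
  \<open>\<tau> (Suc i) j\<close>.\<close>

lemma E_surj: "E i ` carrier (Pr i) = carrier (Y.A i)"
proof
  show "E i ` carrier (Pr i) \<subseteq> carrier (Y.A i)"
    using ring_hom_closed[OF E.ev_hom] by blast
  show "carrier (Y.A i) \<subseteq> E i ` carrier (Pr i)"
  proof -
    have "a \<in> E i ` carrier (Pr i)" if "a \<in> carrier (Y.A i)" for i a
      using that
    proof (induction i arbitrary: a)
      case 0
      then have "a \<in> carrier (X.A 0)" by (simp add: X.carrier_stage_0 Y.carrier_stage_0)
      then show ?case
        using \<alpha>_0 const_closed by (intro image_eqI[of _ _ "ring.indexed_const (X.A 0) a"]) simp_all
    next
      case (Suc i)
      interpret E': ring_hom_cring "Pr (Suc i)" "Y.A (Suc i)" "E (Suc i)" by (rule E_cring_hom)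
      interpret incl: ring_hom_cring "Y.A i" "Y.A (Suc i)" "Y.\<iota> i" by (rule Y.incl_cring_hom)
      have const: "\<alpha> (Suc i) a \<in> E (Suc i) ` carrier (Pr (Suc i))" if "a \<in> carrier (X.A (Suc i))" for a
        using that const_closed by (intro image_eqI[of _ _ "ring.indexed_const (X.A (Suc i)) a"]) simp_all
      have var: "\<tau> (Suc i) j \<in> E (Suc i) ` carrier (Pr (Suc i))" if "j < m" for j
        using that var_closed by (intro image_eqI[of _ _ "ring.indexed_var (X.A (Suc i)) j"]) simp_all
      have varp: "Y.\<iota> i (\<tau> i j) \<in> E (Suc i) ` carrier (Pr (Suc i))" if "j < m" for j
      proof -
        have "\<tau> (Suc i) j [^]\<^bsub>Y.A (Suc i)\<^esub> k \<in> E (Suc i) ` carrier (Pr (Suc i))" for k :: nat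
        proof (induction k)
          case 0
          then show ?case by (simp only: Group.nat_pow_0 E'.image_one)
        next
          case (Suc k)
          then show ?case by (simp only: Group.nat_pow_Suc E'.image_mult var that)
        qed
        then show ?thesis by (simp only: \<tau>_pow_p[OF that, symmetric])
      qed
      have incl_E: "Y.\<iota> i (E i f) \<in> E (Suc i) ` carrier (Pr (Suc i))" if "f \<in> X.stage.S.pset i {..<m}" for f
        using that
      proof (induction rule: X.stage.S.indexed_pset.induct)
        case (indexed_const a)
        then have "Y.\<iota> i (E i (ring.indexed_const (X.A i) a)) = \<alpha> (Suc i) (X.\<iota> i a)"
          by (simp add: \<alpha>_incl)
        then show ?case
          using const[of "X.\<iota> i a"] indexed_const ring_hom_closed[OF X.incl_hom] by simp
      next
        case (indexed_padd f g)
        then show ?case by (simp add: E.ev_add E.ev_closed E'.image_add del: X.stage.S.poly_ring_simps)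
      next
        case (indexed_pmult f j)
        then show ?case
          by (simp add: E.ev_pmult E.ev_closed \<tau>_closed E'.image_mult varp del: X.stage.S.poly_ring_simps)
      qed
      from Suc.prems show ?case
      proof (induction rule: Y.stage_induct)
        case (incl a)
        then obtain f where "f \<in> carrier (Pr i)" "a = E i f" using Suc.IH by blast
        then show ?case using incl_E by simp
      next
        case (root j)
        show ?case
        proof (cases "j < length xs")
          case True
          then show ?thesis using const[OF X.z_closed] by (metis \<alpha>_z)
        next
          case False
          then obtain l where l: "j = length xs + l" "l < m"
            using root by (metis add_less_cancel_left le_add_diff_inverse length_append not_less)
          then show ?thesis
            using E'.image_add[OF var const[OF \<eta>_stage]] by (simp only: Yz_eq)
        qed
      next
        case (add a b)
        then show ?case by (simp only: E'.image_add)
      next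
        case (mult a b)
        then show ?case by (simp only: E'.image_mult)
      qed
    qed
    then show ?thesis by blast
  qed
qed

text \<open>Since \<open>p ^ 0\<close> is 1, \<open>T 0\<close> consists of the polynomials without
  constant term. Hence \<open>f\<close> has the same value as its constant term, and
  \<open>\<alpha> 0\<close> is the identity.\<close>

lemma E_0:
  assumes "f \<in> carrier (Pr 0)" shows "E 0 f = f {#}"
proof -
  interpret E0: ring_hom_cring "Pr 0" "Y.A 0" "E 0" by (rule E_cring_hom)
  let ?c = "ring.indexed_const (X.A 0) (f {#})"
  have f: "f {#} \<in> carrier (X.A 0)" using assms X.stage.S.pset_coeff by simp
  note c = const_closed[OF f]
  have "f \<ominus>\<^bsub>Pr 0\<^esub> ?c = (\<lambda>M. f M \<ominus>\<^bsub>X.A 0\<^esub> ?c M)"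
    using assms c by (intro X.stage.S.poly_minus) simp_all
  then have "f \<ominus>\<^bsub>Pr 0\<^esub> ?c \<in> T 0"
    using E0.R.minus_closed[OF assms c] f
    by (simp add: trunc_ideal_def small_monomial_1 X.stage.S.indexed_const_def X.stage.S.minus_eq X.stage.S.r_neg)
  then have "E 0 (f \<ominus>\<^bsub>Pr 0\<^esub> ?c) = \<zero>\<^bsub>Y.A 0\<^esub>" by (rule E_trunc_ideal)
  then have "E 0 f \<ominus>\<^bsub>Y.A 0\<^esub> E 0 ?c = \<zero>\<^bsub>Y.A 0\<^esub>"
    using assms c by (simp only: E0.R.minus_eq Y.stage.S.minus_eq E0.hom_add E0.hom_a_inv E0.R.a_inv_closed)
  then have "E 0 f = E 0 ?c"
    using E0.hom_closed[OF assms] E0.hom_closed[OF c] by simp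
  then show ?thesis using f \<alpha>_0 by simp
qed

text \<open>In the induction step, the quotient map from \<open>Pr (Suc i)\<close> modulo \<open>T (Suc i)\<close> is factored
  through \<open>E (Suc i)\<close>. The factor \<open>\<psi>\<close> comes from the universal property of adjoining roots, applied
  to the map \<open>\<theta>\<close> that sends \<open>\<tau> i j\<close> to the \<open>p\<close>-th power of the \<open>j\<close>-th variable; \<open>\<theta>\<close> is well
  defined because, by induction, the kernel of \<open>E i\<close> is \<open>T i\<close>.\<close>

lemma E_ker:
  assumes "f \<in> carrier (Pr i)" "E i f = \<zero>\<^bsub>Y.A i\<^esub>" shows "f \<in> T i"
  using assms
proof (induction i arbitrary: f)
  case 0
  \<comment> \<open>Both towers start with the same copy of \<open>R\<close>, so the two zeros are
    one element.\<close>
  have "\<zero>\<^bsub>Y.A 0\<^esub> = \<zero>\<^bsub>X.A 0\<^esub>" by (simp add: X.stage_0 Y.stage_0 image_ring_zero)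
  then show ?case using 0 E_0[OF 0(1)] by (simp add: trunc_ideal_def small_monomial_1)
next
  case (Suc i)
  let ?P = "Pr (Suc i)" and ?I = "T (Suc i)" and ?A = "X.A (Suc i)"
  define Q where "Q = ?P Quot ?I"
  define q where "q = (+>\<^bsub>?P\<^esub>) ?I"
  interpret I: ideal ?I ?P by (rule X.stage.S.trunc_ideal_ideal)
  interpret q: ring_hom_cring ?P Q q
    unfolding Q_def q_def by (rule I.rcos_ring_hom_cring[OF Pr_cring])
  interpret Esuc: ring_hom_cring ?P "Y.A (Suc i)" "E (Suc i)" by (rule E_cring_hom)
  define c where "c a = q (ring.indexed_const ?A a)" for a
  define v where "v j = q (ring.indexed_var ?A j)" for j
  have c_hom: "c \<in> ring_hom ?A Q"
    using ring_hom_trans[OF X.stage.S.indexed_const_hom q.homh] by (simp add: c_def[abs_def] comp_def)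
  interpret c: ring_hom_cring ?A Q c
    by (intro ring_hom_cring.intro ring_hom_cring_axioms.intro X.stage_cring q.S.is_cring c_hom)
  have char: "has_char p Q"
    by (rule has_char_hom[OF X.stage.char c_hom X.stage_cring q.S.is_cring])
  have v_closed: "v j \<in> carrier Q" if "j < m" for j
    unfolding v_def using var_closed[OF that] by (rule q.hom_closed)
  have v_pow: "v j [^]\<^bsub>Q\<^esub> (p ^ Suc i) = \<zero>\<^bsub>Q\<^esub>" if "j < m" for j
  proof -
    have "ring.indexed_var ?A j [^]\<^bsub>?P\<^esub> (p ^ Suc i) \<in> ?I"
      using that by (intro X.stage.S.indexed_var_pow_trunc) simp
    then have "q (ring.indexed_var ?A j [^]\<^bsub>?P\<^esub> (p ^ Suc i)) = \<zero>\<^bsub>Q\<^esub>"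
      unfolding q_def Q_def by (simp only: FactRing_def ring.simps I.a_rcos_const)
    then show ?thesis
      using var_closed[OF that] by (simp only: v_def q.ring.hom_nat_pow)
  qed
  have c\<iota>_hom: "c \<circ> X.\<iota> i \<in> ring_hom (X.A i) Q" by (rule ring_hom_trans[OF X.incl_hom c_hom])
  have v_p_closed: "v j [^]\<^bsub>Q\<^esub> p \<in> carrier Q" if "j < m" for j
    using v_closed[OF that] by (rule q.S.nat_pow_closed)
  interpret E': poly_evaluation "X.A i" Q "c \<circ> X.\<iota> i" "{..<m}" "\<lambda>j. v j [^]\<^bsub>Q\<^esub> p"
    using c\<iota>_hom X.stage_cring[of i] q.S.is_cring v_p_closed
    by (simp only: poly_evaluation_def poly_evaluation_axioms_def ring_hom_cring_def
        ring_hom_cring_axioms_def lessThan_iff simp_thms) blast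
  \<comment> \<open>\<open>E'\<close> evaluates at the \<open>p\<close>-th powers of the classes
    \<open>v j\<close>; raised to \<open>p ^ i\<close> these become \<open>p ^ Suc i\<close>-th
    powers of \<open>v j\<close>, which are zero in \<open>Q\<close>.\<close>
  have "E'.ev g = \<zero>\<^bsub>Q\<^esub>" if "g \<in> carrier (Pr i)" "E i g = \<zero>\<^bsub>Y.A i\<^esub>" for g
  proof (rule E'.ev_trunc_ideal)
    show "g \<in> T i" using Suc.IH that by blast
    show "(v j [^]\<^bsub>Q\<^esub> p) [^]\<^bsub>Q\<^esub> (p ^ i) = \<zero>\<^bsub>Q\<^esub>" if "j \<in> {..<m}" for j
      using v_pow[of j] v_closed[of j] that by (simp add: q.S.nat_pow_pow)
  qed (use p_pos in simp)
  then obtain \<theta> where \<theta>: "\<theta> \<in> ring_hom (Y.A i) Q" "\<And>g. g \<in> carrier (Pr i) \<Longrightarrow> \<theta> (E i g) = E'.ev g"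
    using hom_factor[OF Pr_cring Y.stage_cring q.S.is_cring E.ev_hom E'.ev_hom E_surj] by blast
  have \<theta>_\<alpha>: "\<theta> (\<alpha> i a) = c (X.\<iota> i a)" if "a \<in> carrier (X.A i)" for a
    using \<theta>(2)[OF const_closed[OF that]] that by simp
  have \<theta>_\<tau>: "\<theta> (\<tau> i j) = v j [^]\<^bsub>Q\<^esub> p" if "j < m" for j
    using \<theta>(2)[OF var_closed[OF that, of i]] that by simp
  \<comment> \<open>These values are forced. Roots for \<open>xs\<close> come from the first tower,
    where \<open>\<psi>\<close> has to restrict to \<open>c\<close>; a root for \<open>ys\<close> is
    \<open>\<tau>\<close> plus a lift, and \<open>\<tau>\<close> is to be sent to the class of the
    variable.\<close>
  define d where "d j = (if j < length xs then c (X.z (Suc i) ! j)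
      else v (j - length xs) \<oplus>\<^bsub>Q\<^esub> c (\<eta> (j - length xs) (Suc i)))" for j
  have d_closed: "d j \<in> carrier Q" if "j < length (xs @ ys)" for j
    using that v_closed \<eta>_stage X.z_closed by (auto simp: d_def)
  have d_pow: "d j [^]\<^bsub>Q\<^esub> p = \<theta> (Y.z i ! j)" if j: "j < length (xs @ ys)" for j
  proof (cases "j < length xs")
    case True
    then have "d j [^]\<^bsub>Q\<^esub> p = c (X.z (Suc i) ! j [^]\<^bsub>?A\<^esub> p)"
      using X.z_closed[OF True, of "Suc i"] by (simp add: d_def c.ring.hom_nat_pow)
    then show ?thesis
      using True X.z_closed[OF True, of i] by (simp add: X.z_pow \<theta>_\<alpha> \<alpha>_z[symmetric])
  next
    case False
    define l where "l = j - length xs"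
    have l: "l < m" "j = length xs + l" using False j by (auto simp: l_def)
    have \<eta>: "\<eta> l (Suc i) \<in> carrier ?A" "\<eta> l i \<in> carrier (X.A i)" using l \<eta>_stage by auto
    have "d j [^]\<^bsub>Q\<^esub> p = v l [^]\<^bsub>Q\<^esub> p \<oplus>\<^bsub>Q\<^esub> c (\<eta> l (Suc i)) [^]\<^bsub>Q\<^esub> p"
      using l \<eta> v_closed by (simp add: d_def q.S.frobenius_add[OF X.prime char])
    \<comment> \<open>The \<open>p\<close>-th power of \<open>\<eta> l (Suc i)\<close> is the
      inclusion of its image under the transition map, and that image is \<open>\<eta> l i\<close>
      because \<open>\<eta> l\<close> lies in the limit.\<close>
    also have "c (\<eta> l (Suc i)) [^]\<^bsub>Q\<^esub> p = c (X.\<iota> i (\<eta> l i))"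
      using \<eta> X.incl_phi[OF \<eta>(1)] X.gabber_phi[OF \<eta>_closed[OF l(1)], of i]
      by (simp add: c.ring.hom_nat_pow)
    also have "v l [^]\<^bsub>Q\<^esub> p \<oplus>\<^bsub>Q\<^esub> c (X.\<iota> i (\<eta> l i)) = \<theta> (\<tau> i l) \<oplus>\<^bsub>Q\<^esub> \<theta> (\<alpha> i (\<eta> l i))"
      using l \<eta> by (simp add: \<theta>_\<alpha> \<theta>_\<tau>)
    also have "\<dots> = \<theta> (Y.z i ! j)"
      using l \<eta> by (simp only: l Yz_eq ring_hom_add[OF \<theta>(1)] \<tau>_closed \<alpha>_closed)
    finally show ?thesis .
  qed
  obtain \<psi> where \<psi>: "\<psi> \<in> ring_hom (Y.A (Suc i)) Q"
    "\<And>a. a \<in> carrier (Y.A i) \<Longrightarrow> \<psi> (Y.\<iota> i a) = \<theta> a"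
    "\<And>j. j < length (xs @ ys) \<Longrightarrow> \<psi> (Y.z (Suc i) ! j) = d j"
    using Y.stage_lift[OF q.S.is_cring \<theta>(1) d_closed d_pow] by blast
  interpret \<psi>: ring_hom_cring "Y.A (Suc i)" Q \<psi>
    by (intro ring_hom_cring.intro ring_hom_cring_axioms.intro Y.stage_cring q.S.is_cring \<psi>(1))
  have \<psi>_\<alpha>: "\<psi> (\<alpha> (Suc i) a) = c a" if "a \<in> carrier ?A" for a
  proof -
    have "(\<psi> \<circ> \<alpha> (Suc i)) a = c a"
    proof (rule X.stage_hom_eq[of "\<psi> \<circ> \<alpha> (Suc i)" i Q c a])
      show "(\<psi> \<circ> \<alpha> (Suc i)) (X.\<iota> i b) = c (X.\<iota> i b)" if "b \<in> carrier (X.A i)" for b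
        using that by (simp add: \<alpha>_incl \<psi>(2) \<alpha>_closed \<theta>_\<alpha>)
      show "(\<psi> \<circ> \<alpha> (Suc i)) (X.z (Suc i) ! j) = c (X.z (Suc i) ! j)" if "j < length xs" for j
        using that \<psi>(3)[of j] by (simp add: \<alpha>_z d_def)
    qed (use that c_hom ring_hom_trans[OF \<alpha>_hom \<psi>(1)] in auto)
    then show ?thesis by simp
  qed
  have \<psi>_\<tau>: "\<psi> (\<tau> (Suc i) j) = v j" if j: "j < m" for j
  proof -
    have \<eta>: "\<eta> j (Suc i) \<in> carrier ?A" using j by (rule \<eta>_stage)
    have "\<psi> (\<tau> (Suc i) j) = \<psi> (Y.z (Suc i) ! (length xs + j)) \<ominus>\<^bsub>Q\<^esub> \<psi> (\<alpha> (Suc i) (\<eta> j (Suc i)))"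
      using Yz_closed[OF j, of "Suc i"] \<alpha>_closed[OF \<eta>]
      by (simp only: \<tau>_def Y.stage.S.minus_eq q.S.minus_eq \<psi>.hom_add \<psi>.hom_a_inv Y.stage.S.a_inv_closed)
    also have "\<dots> = (v j \<oplus>\<^bsub>Q\<^esub> c (\<eta> j (Suc i))) \<ominus>\<^bsub>Q\<^esub> c (\<eta> j (Suc i))"
      using j \<eta> \<psi>(3)[of "length xs + j"] by (simp add: \<psi>_\<alpha> d_def)
    also have "\<dots> = v j"
      using v_closed[OF j] c.hom_closed[OF \<eta>] by (simp add: q.S.minus_eq q.S.a_assoc q.S.r_neg)
    finally show ?thesis .
  qed
  \<comment> \<open>The quotient map factors through \<open>E (Suc i)\<close>, so a polynomial
    killed by \<open>E (Suc i)\<close> is zero in \<open>Q\<close>, that is, lies in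
    \<open>T (Suc i)\<close>.\<close>
  have "(\<psi> \<circ> E (Suc i)) f = q f"
  proof (rule poly_ring_hom_eq[of ?A "\<psi> \<circ> E (Suc i)" "{..<m}" Q q])
    show "\<psi> \<circ> E (Suc i) \<in> ring_hom ?P Q" by (rule ring_hom_trans[OF E.ev_hom \<psi>(1)])
    show "(\<psi> \<circ> E (Suc i)) (ring.indexed_const ?A a) = q (ring.indexed_const ?A a)" if "a \<in> carrier ?A" for a
      using that \<psi>_\<alpha> by (simp add: c_def)
    show "(\<psi> \<circ> E (Suc i)) (ring.indexed_var ?A j) = q (ring.indexed_var ?A j)" if "j \<in> {..<m}" for j
      using that \<psi>_\<tau> by (simp add: v_def)
  qed (use Suc.prems(1) q.homh X.stage_cring in blast)+
  then have "q f = \<zero>\<^bsub>Q\<^esub>" using Suc.prems(2) by simp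
  then have "?I +>\<^bsub>?P\<^esub> f = ?I" by (simp add: q_def Q_def FactRing_def)
  then show ?case using Suc.prems(1) by (intro I.rcos_const_imp_mem)
qed

text \<open>The kernel in the form used for the limit: stage \<open>i\<close> records exactly the
  coefficients at monomials with all exponents below \<open>p ^ i\<close>.\<close>

lemma E_eq_iff:
  assumes "f \<in> carrier (Pr i)" "g \<in> carrier (Pr i)"
  shows "E i f = E i g \<longleftrightarrow> (\<forall>M. small_monomial (p ^ i) M \<longrightarrow> f M = g M)"
proof -
  interpret Ei: ring_hom_cring "Pr i" "Y.A i" "E i" by (rule E_cring_hom)
  have "E i (f \<ominus>\<^bsub>Pr i\<^esub> g) = E i f \<ominus>\<^bsub>Y.A i\<^esub> E i g"
    using assms by (simp only: Ei.R.minus_eq Y.stage.S.minus_eq Ei.hom_add Ei.hom_a_inv Ei.R.a_inv_closed)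
  then have "E i f = E i g \<longleftrightarrow> E i (f \<ominus>\<^bsub>Pr i\<^esub> g) = \<zero>\<^bsub>Y.A i\<^esub>"
    using Ei.hom_closed[OF assms(1)] Ei.hom_closed[OF assms(2)] by simp
  also have "\<dots> \<longleftrightarrow> f \<ominus>\<^bsub>Pr i\<^esub> g \<in> T i"
    using E_ker[OF Ei.R.minus_closed[OF assms]] E_trunc_ideal by blast
  also have "\<dots> \<longleftrightarrow> (\<forall>M. small_monomial (p ^ i) M \<longrightarrow> f M \<ominus>\<^bsub>X.A i\<^esub> g M = \<zero>\<^bsub>X.A i\<^esub>)"
  proof -
    have "f \<ominus>\<^bsub>Pr i\<^esub> g = (\<lambda>M. f M \<ominus>\<^bsub>X.A i\<^esub> g M)"
      using assms by (intro X.stage.S.poly_minus) simp_all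
    then show ?thesis using Ei.R.minus_closed[OF assms] by (simp add: trunc_ideal_def)
  qed
  also have "\<dots> \<longleftrightarrow> (\<forall>M. small_monomial (p ^ i) M \<longrightarrow> f M = g M)"
    using assms X.stage.S.pset_coeff[of f i "{..<m}"] X.stage.S.pset_coeff[of g i "{..<m}"] by simp
  finally show ?thesis .
qed

section \<open>Passage to the limit\<close>

abbreviation "SR \<equiv> series_ring X.G {..<m}"

definition "at_level i f = (\<lambda>M. f M i)"

text \<open>An infinite series cannot be evaluated at \<open>\<tau> i\<close> directly. The
  discarded monomials are those that vanish there by nilpotence, and with finitely many variables
  the remaining part is a polynomial.\<close>

definition "\<Phi> f = (\<lambda>i. E i (trunc_series (X.A i) (p ^ i) (at_level i f)))"

text \<open>Every coefficient of a series is thus visible from some stage on. The stage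
  \<open>size M\<close> works because exponents are at most \<open>size M\<close>, which is less
  than \<open>2 ^ size M\<close>.\<close>

lemma exists_small: "\<exists>i. small_monomial (p ^ i) M"
proof (intro exI)
  have "count M j < p ^ size M" for j
  proof -
    have "count M j \<le> size M" by (rule count_le_size)
    also have "\<dots> < 2 ^ size M" by (rule less_exp)
    also have "\<dots> \<le> p ^ size M" using X.prime by (intro power_mono prime_ge_2_nat) auto
    finally show ?thesis .
  qed
  then show "small_monomial (p ^ size M) M" by (simp add: small_monomial_def)
qed

lemma small_monomial_level:
  assumes "small_monomial (p ^ i) M" "i \<le> k" shows "small_monomial (p ^ k) M"
  using assms p_pos by (intro small_monomial_mono[OF assms(1)] power_increasing) simp_all

lemma SR_coeff: "f \<in> carrier SR \<Longrightarrow> f M \<in> carrier X.G"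
  by (simp add: X.G.series_ring_simps)

lemma at_level_closed: "f \<in> carrier SR \<Longrightarrow> at_level i f \<in> carrier (series_ring (X.A i) {..<m})"
  by (auto simp: X.G.series_ring_simps X.stage.S.series_ring_simps at_level_def X.gabber_closed)

lemma at_level_mult:
  assumes "f \<in> carrier SR" "g \<in> carrier SR"
  shows "at_level i (f \<otimes>\<^bsub>SR\<^esub> g) = series_mult (X.A i) (at_level i f) (at_level i g)"
proof
  fix M
  have "(\<lambda>N. f N \<otimes>\<^bsub>X.G\<^esub> g (M - N)) \<in> {N. N \<subseteq># M} \<rightarrow> carrier X.G"
    using assms[THEN SR_coeff] by (intro funcsetI X.G.m_closed)
  then show "at_level i (f \<otimes>\<^bsub>SR\<^esub> g) M = series_mult (X.A i) (at_level i f) (at_level i g) M"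
    unfolding at_level_def X.G.series_ring_simps series_mult_def
    by (simp add: X.gabber_finsum[OF finite_submultisets])
qed

lemma trunc_closed: "f \<in> carrier SR \<Longrightarrow> trunc_series (X.A i) q (at_level i f) \<in> carrier (Pr i)"
  using X.stage.S.trunc_series_closed[OF finite_lessThan at_level_closed] by simp

text \<open>Since \<open>\<tau> (Suc i) j\<close> goes to \<open>\<tau> i j\<close>, the transition
  map leaves the variables fixed and acts on the coefficients through the first tower.\<close>

lemma \<phi>_E:
  assumes "f \<in> carrier (Pr (Suc i))"
  shows "(\<lambda>M. X.\<phi> i (f M)) \<in> carrier (Pr i)"
    and "Y.\<phi> i (E (Suc i) f) = E i (\<lambda>M. X.\<phi> i (f M))"
  using poly_eval_map[OF poly_evaluation_\<tau> poly_evaluation_\<tau> Y.phi_hom X.phi_hom \<phi>_\<alpha> \<phi>_\<tau>,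
      of i f] assms by simp_all

lemma \<Phi>_closed:
  assumes "f \<in> carrier SR" shows "\<Phi> f \<in> carrier Y.G"
  unfolding Y.gabber_carrier
proof (intro allI conjI)
  fix i
  show "\<Phi> f i \<in> carrier (Y.A i)"
    unfolding \<Phi>_def by (rule ring_hom_closed[OF E.ev_hom trunc_closed[OF assms]])
  let ?t = "trunc_series (X.A (Suc i)) (p ^ Suc i) (at_level (Suc i) f)"
  note map = \<phi>_E[OF trunc_closed[OF assms], of i "p ^ Suc i"]
  have phi0: "X.\<phi> i \<zero>\<^bsub>X.A (Suc i)\<^esub> = \<zero>\<^bsub>X.A i\<^esub>"
    by (rule ring_hom_cring.hom_zero[OF X.phi_cring_hom])
  have "Y.\<phi> i (\<Phi> f (Suc i)) = E i (\<lambda>M. X.\<phi> i (?t M))"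
    unfolding \<Phi>_def using map(2) by simp
  \<comment> \<open>At monomials small for \<open>p ^ i\<close> the coefficients match because they
    come from elements of the limit. Monomials small only for \<open>p ^ Suc i\<close> may remain on
    the left, and \<open>E_eq_iff\<close> ignores them.\<close>
  also have "\<dots> = \<Phi> f i"
    unfolding \<Phi>_def
    by (subst E_eq_iff[OF map(1) trunc_closed[OF assms]])
      (auto simp: trunc_series_def at_level_def X.gabber_phi[OF SR_coeff[OF assms]]
        dest: small_monomial_level[of i _ "Suc i"])
  finally show "Y.\<phi> i (\<Phi> f (Suc i)) = \<Phi> f i" .
qed

lemma \<Phi>_add:
  assumes "f \<in> carrier SR" "g \<in> carrier SR" shows "\<Phi> (f \<oplus>\<^bsub>SR\<^esub> g) = \<Phi> f \<oplus>\<^bsub>Y.G\<^esub> \<Phi> g"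
proof
  fix i
  interpret Ei: ring_hom_cring "Pr i" "Y.A i" "E i" by (rule E_cring_hom)
  let ?t = "\<lambda>f. trunc_series (X.A i) (p ^ i) (at_level i f)"
  have "?t (f \<oplus>\<^bsub>SR\<^esub> g) = ?t f \<oplus>\<^bsub>Pr i\<^esub> ?t g"
    by (auto simp: trunc_series_def at_level_def X.G.series_ring_simps fun_eq_iff)
  then show "\<Phi> (f \<oplus>\<^bsub>SR\<^esub> g) i = (\<Phi> f \<oplus>\<^bsub>Y.G\<^esub> \<Phi> g) i"
    using Ei.hom_add[OF trunc_closed[OF assms(1)] trunc_closed[OF assms(2)]]
    by (simp only: \<Phi>_def Y.gabber_ring_simps)
qed

text \<open>The truncation of a product and the product of the truncations differ only at monomials
  that are not small, which \<open>E i\<close> does not see.\<close>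

lemma \<Phi>_mult:
  assumes "f \<in> carrier SR" "g \<in> carrier SR" shows "\<Phi> (f \<otimes>\<^bsub>SR\<^esub> g) = \<Phi> f \<otimes>\<^bsub>Y.G\<^esub> \<Phi> g"
proof
  fix i
  interpret Ei: ring_hom_cring "Pr i" "Y.A i" "E i" by (rule E_cring_hom)
  interpret SR: cring SR by (rule X.G.series_ring_cring)
  let ?t = "\<lambda>f. trunc_series (X.A i) (p ^ i) (at_level i f)"
  have c: "at_level i f M \<in> carrier (X.A i)" "at_level i g M \<in> carrier (X.A i)" for M
    unfolding at_level_def by (rule X.gabber_closed[OF SR_coeff], rule assms)+
  have "E i (?t (f \<otimes>\<^bsub>SR\<^esub> g)) = E i (?t f \<otimes>\<^bsub>Pr i\<^esub> ?t g)"
  proof (subst E_eq_iff)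
    show "?t (f \<otimes>\<^bsub>SR\<^esub> g) \<in> carrier (Pr i)" by (rule trunc_closed[OF SR.m_closed[OF assms]])
    show "?t f \<otimes>\<^bsub>Pr i\<^esub> ?t g \<in> carrier (Pr i)"
      by (rule Ei.R.m_closed[OF trunc_closed[OF assms(1)] trunc_closed[OF assms(2)]])
    show "\<forall>M. small_monomial (p ^ i) M \<longrightarrow> ?t (f \<otimes>\<^bsub>SR\<^esub> g) M = (?t f \<otimes>\<^bsub>Pr i\<^esub> ?t g) M"
    proof (intro allI impI)
      fix M :: "nat multiset" assume M: "small_monomial (p ^ i) M"
      have "(?t f \<otimes>\<^bsub>Pr i\<^esub> ?t g) M = series_mult (X.A i) (at_level i f) (at_level i g) M"
        unfolding X.stage.S.poly_ring_simps by (rule X.stage.S.trunc_series_mult[OF c M])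
      moreover have "?t (f \<otimes>\<^bsub>SR\<^esub> g) M = at_level i (f \<otimes>\<^bsub>SR\<^esub> g) M"
        using M by (simp only: trunc_series_def if_True)
      ultimately show "?t (f \<otimes>\<^bsub>SR\<^esub> g) M = (?t f \<otimes>\<^bsub>Pr i\<^esub> ?t g) M"
        by (simp only: at_level_mult[OF assms])
    qed
  qed
  also have "\<dots> = E i (?t f) \<otimes>\<^bsub>Y.A i\<^esub> E i (?t g)"
    by (rule Ei.hom_mult[OF trunc_closed[OF assms(1)] trunc_closed[OF assms(2)]])
  finally show "\<Phi> (f \<otimes>\<^bsub>SR\<^esub> g) i = (\<Phi> f \<otimes>\<^bsub>Y.G\<^esub> \<Phi> g) i"
    by (simp only: \<Phi>_def Y.gabber_ring_simps)
qed

lemma \<Phi>_one: "\<Phi> \<one>\<^bsub>SR\<^esub> = \<one>\<^bsub>Y.G\<^esub>"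
proof
  fix i
  interpret Ei: ring_hom_cring "Pr i" "Y.A i" "E i" by (rule E_cring_hom)
  have "trunc_series (X.A i) (p ^ i) (at_level i \<one>\<^bsub>SR\<^esub>) = \<one>\<^bsub>Pr i\<^esub>"
    using p_pos
    by (auto simp: trunc_series_def at_level_def X.G.series_ring_simps X.G.indexed_const_def
        X.stage.S.indexed_const_def fun_eq_iff small_monomial_def)
  then show "\<Phi> \<one>\<^bsub>SR\<^esub> i = \<one>\<^bsub>Y.G\<^esub> i"
    by (simp only: \<Phi>_def Ei.hom_one Y.gabber_ring_simps)
qed

lemma \<Phi>_inj: "inj_on \<Phi> (carrier SR)"
proof (rule inj_onI)
  fix f g assume f: "f \<in> carrier SR" and g: "g \<in> carrier SR" and eq: "\<Phi> f = \<Phi> g"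
  have small: "f M i = g M i" if M: "small_monomial (p ^ i) M" for M i
  proof -
    have "E i (trunc_series (X.A i) (p ^ i) (at_level i f)) = E i (trunc_series (X.A i) (p ^ i) (at_level i g))"
      using eq by (simp only: \<Phi>_def fun_eq_iff)
    then show ?thesis
      using M unfolding E_eq_iff[OF trunc_closed[OF f] trunc_closed[OF g]]
      by (auto simp: trunc_series_def at_level_def)
  qed
  have "f M i = g M i" for M i
  proof -
    obtain k where k: "small_monomial (p ^ k) M" using exists_small by blast
    show ?thesis
      \<comment> \<open>At stage \<open>max i k\<close> the monomial is small, so the coefficients
        agree there; the transition maps bring the equality down to stage \<open>i\<close>.\<close>
      by (rule X.gabber_eq_below[OF SR_coeff[OF f] SR_coeff[OF g] small max.cobounded1])
        (rule small_monomial_level[OF k max.cobounded2])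
  qed
  then show "f = g" by blast
qed

text \<open>The preimages \<open>f i\<close> are arbitrary outside the small monomials and need not
  be compatible as polynomials. At a fixed \<open>M\<close> their coefficients are compatible from
  the first stage where \<open>M\<close> is small, and \<open>gabber_extend\<close> completes this
  tail.\<close>

lemma \<Phi>_surj:
  assumes s: "s \<in> carrier Y.G" shows "s \<in> \<Phi> ` carrier SR"
proof -
  have ex_f: "\<exists>f. f \<in> carrier (Pr i) \<and> E i f = s i" for i
  proof -
    have "s i \<in> E i ` carrier (Pr i)" unfolding E_surj by (rule Y.gabber_closed[OF s])
    then show ?thesis by (auto simp only: image_iff)
  qed
  define f where "f i = (SOME f. f \<in> carrier (Pr i) \<and> E i f = s i)" for i
  have f: "f i \<in> carrier (Pr i)" "E i (f i) = s i" for i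
    using someI_ex[OF ex_f, of i] unfolding f_def by simp_all
  have phi_f: "X.\<phi> i (f (Suc i) M) = f i M" if M: "small_monomial (p ^ i) M" for i M
  proof -
    note map = \<phi>_E[OF f(1)[of "Suc i"]]
    have "E i (\<lambda>M. X.\<phi> i (f (Suc i) M)) = E i (f i)"
      using map(2) f(2) Y.gabber_phi[OF s, of i] by simp
    then have "\<forall>M. small_monomial (p ^ i) M \<longrightarrow> X.\<phi> i (f (Suc i) M) = f i M"
      using E_eq_iff[OF map(1) f(1)[of i]] by blast
    then show ?thesis using M by blast
  qed
  have f_closed: "f i M \<in> carrier (X.A i)" for i M
    using f(1)[of i] X.stage.S.pset_coeff[of "f i" i "{..<m}"] by simp
  have ex_t: "\<exists>t. t \<in> carrier X.G \<and> (\<forall>i. small_monomial (p ^ i) M \<longrightarrow> t i = f i M)" for M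
  proof -
    define N where "N = (LEAST i. small_monomial (p ^ i) M)"
    have N: "small_monomial (p ^ i) M \<longleftrightarrow> N \<le> i" for i
      using exists_small[of M] small_monomial_level unfolding N_def by (metis LeastI Least_le)
    have "f i M \<in> carrier (X.A i) \<and> X.\<phi> i (f (Suc i) M) = f i M" if "N \<le> i" for i
      using f_closed phi_f that N by simp
    then obtain t where "t \<in> carrier X.G" "\<And>i. N \<le> i \<Longrightarrow> t i = f i M"
      by (rule X.gabber_extend[of N "\<lambda>i. f i M"]) blast+
    then show ?thesis using N by blast
  qed
  define t where "t M = (SOME t. t \<in> carrier X.G \<and> (\<forall>i. small_monomial (p ^ i) M \<longrightarrow> t i = f i M))" for M
  have t: "t M \<in> carrier X.G" "small_monomial (p ^ i) M \<Longrightarrow> t M i = f i M" for M i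
    using someI_ex[OF ex_t, of M] unfolding t_def by blast+
  \<comment> \<open>The support condition is imposed by hand. At the excluded monomials the
    \<open>f i\<close> vanish as well, so \<open>F\<close> still agrees with them.\<close>
  define F where "F M = (if set_mset M \<subseteq> {..<m} then t M else \<zero>\<^bsub>X.G\<^esub>)" for M
  have F: "F \<in> carrier SR"
    using t(1) X.G.zero_closed by (simp add: X.G.series_ring_simps F_def del: X.gabber_ring_simps)
  have "\<Phi> F i = s i" for i
  proof -
    have "F M i = f i M" if M: "small_monomial (p ^ i) M" for M
    proof (cases "set_mset M \<subseteq> {..<m}")
      case True
      then show ?thesis using t(2)[OF M] by (simp add: F_def)
    next
      case False
      then show ?thesis
        using X.stage.S.pset_support[of "f i" i "{..<m}" M] f(1)[of i] by (simp add: F_def)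
    qed
    then have "E i (trunc_series (X.A i) (p ^ i) (at_level i F)) = E i (f i)"
      by (subst E_eq_iff[OF trunc_closed[OF F] f(1)]) (simp add: trunc_series_def at_level_def)
    then show ?thesis by (simp only: \<Phi>_def f(2))
  qed
  then have "\<Phi> F = s" by blast
  then show ?thesis using F by blast
qed

lemma \<Phi>_iso: "\<Phi> \<in> ring_iso SR Y.G"
proof (rule ring_iso_memI)
  show "bij_betw \<Phi> (carrier SR) (carrier Y.G)"
    unfolding bij_betw_def using \<Phi>_inj \<Phi>_closed \<Phi>_surj by blast
qed (rule \<Phi>_closed \<Phi>_mult \<Phi>_add \<Phi>_one; assumption)+

lemma \<Phi>_proj:
  assumes "f \<in> carrier SR" shows "gabber_proj (\<Phi> f) = series_proj f"
proof -
  have "\<Phi> f 0 = trunc_series (X.A 0) (p ^ 0) (at_level 0 f) {#}"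
    unfolding \<Phi>_def by (rule E_0[OF trunc_closed[OF assms]])
  then show ?thesis
    by (simp add: gabber_proj_def series_proj_def trunc_series_def at_level_def small_monomial_1)
qed

end

section \<open>Construction of the comparison data and conclusion\<close>

theorem corollary3p2p6:
  fixes p :: nat and R :: "('a, 'b) ring_scheme" and xs ys :: "'a list"
  assumes "Factorial_Ring.prime p"
    and "cring R" and "has_char p R"
    and "noetherian_ring R" and "F_finite p R"
    and "p_generating p R xs"
    and "set ys \<subseteq> carrier R"
  shows "\<exists>h \<in> ring_iso (gabber_ring p R (xs @ ys))
                      (series_ring (gabber_ring p R xs) {..<length ys}).
           \<forall>s \<in> carrier (gabber_ring p R (xs @ ys)). gabber_proj s = series_proj (h s)"
proof -
  have xs: "set xs \<subseteq> carrier R" using assms(6) by (simp add: p_generating_def)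
  interpret X: gabber_tower p R xs by (rule gabber_tower.intro) (use assms xs in auto)
  interpret Y: gabber_tower p R "xs @ ys" by (rule gabber_tower.intro) (use assms xs in auto)
  define good where "good i \<alpha> \<longleftrightarrow> \<alpha> \<in> ring_hom (X.A i) (Y.A i) \<and>
      (i = 0 \<longrightarrow> (\<forall>a\<in>carrier (X.A 0). \<alpha> a = a)) \<and> (\<forall>j<length xs. \<alpha> (X.z i ! j) = Y.z i ! j)" for i \<alpha>
  \<comment> \<open>Compatibility with the inclusions links consecutive stages, so each map is built
    from the previous one by dependent choice.\<close>
  have "\<exists>\<alpha>. \<forall>i. good i (\<alpha> i) \<and> (\<forall>a\<in>carrier (X.A i). \<alpha> (Suc i) (X.\<iota> i a) = Y.\<iota> i (\<alpha> i a))"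
  proof (rule dependent_nat_choice)
    \<comment> \<open>Stage 0 depends on \<open>R\<close> and not on the tuple, so the identity
      starts the recursion.\<close>
    have "X.A 0 = Y.A 0" by (simp add: X.stage_0 Y.stage_0)
    then have "id \<in> ring_hom (X.A 0) (Y.A 0)" by simp
    moreover have "\<forall>j<length xs. X.z 0 ! j = Y.z 0 ! j"
      by (simp add: X.stage_0 Y.stage_0 nth_append)
    ultimately show "\<exists>\<alpha>. good 0 \<alpha>" unfolding good_def by (intro exI[of _ id]) simp
  next
    fix \<alpha> i assume "good i \<alpha>"
    then have \<alpha>: "\<alpha> \<in> ring_hom (X.A i) (Y.A i)" "\<And>j. j < length xs \<Longrightarrow> \<alpha> (X.z i ! j) = Y.z i ! j"
      by (simp_all add: good_def)
    \<comment> \<open>Each root goes to the root with the same index in the second tower; the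
      required \<open>p\<close>-th power relation is \<open>Y.z_pow\<close>.\<close>
    obtain \<beta> where "\<beta> \<in> ring_hom (X.A (Suc i)) (Y.A (Suc i))"
      "\<And>a. a \<in> carrier (X.A i) \<Longrightarrow> \<beta> (X.\<iota> i a) = (Y.\<iota> i \<circ> \<alpha>) a"
      "\<And>j. j < length xs \<Longrightarrow> \<beta> (X.z (Suc i) ! j) = Y.z (Suc i) ! j"
    proof (rule X.stage_lift[where D = "Y.A (Suc i)" and h = "Y.\<iota> i \<circ> \<alpha>" and d = "\<lambda>j. Y.z (Suc i) ! j"])
      show "Y.\<iota> i \<circ> \<alpha> \<in> ring_hom (X.A i) (Y.A (Suc i))"
        by (rule ring_hom_trans[OF \<alpha>(1) Y.incl_hom])
      show "Y.z (Suc i) ! j \<in> carrier (Y.A (Suc i))" if "j < length xs" for j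
        using that by (intro Y.z_closed) simp
      show "Y.z (Suc i) ! j [^]\<^bsub>Y.A (Suc i)\<^esub> p = (Y.\<iota> i \<circ> \<alpha>) (X.z i ! j)" if "j < length xs" for j
        using that \<alpha>(2) by (simp add: Y.z_pow)
    qed (use Y.stage_cring in auto)
    then show "\<exists>\<beta>. good (Suc i) \<beta> \<and> (\<forall>a\<in>carrier (X.A i). \<beta> (X.\<iota> i a) = Y.\<iota> i (\<alpha> a))"
      unfolding good_def by auto
  qed
  then obtain \<alpha> where \<alpha>: "good i (\<alpha> i)" "a \<in> carrier (X.A i) \<Longrightarrow> \<alpha> (Suc i) (X.\<iota> i a) = Y.\<iota> i (\<alpha> i a)" for i a
    by blast
  \<comment> \<open>Here \<open>p\<close>-generation by \<open>xs\<close> enters, through the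
    surjectivity of the transition maps.\<close>
  have "\<exists>s. s \<in> carrier X.G \<and> s 0 = Base (ys ! j)" if "j < length ys" for j
  proof -
    have "Base (ys ! j) \<in> carrier (X.A 0)" using that assms(7) nth_mem unfolding X.carrier_stage_0 by blast
    then show ?thesis using X.gabber_proj_surj[OF assms(6)] by metis
  qed
  then obtain \<eta> where \<eta>: "j < length ys \<Longrightarrow> \<eta> j \<in> carrier X.G \<and> \<eta> j 0 = Base (ys ! j)" for j
    by metis
  interpret gabber_comparison p R xs ys \<alpha> \<eta>
    by unfold_locales (use \<alpha> \<eta> in \<open>auto simp: good_def\<close>)
  have "cring SR" by (rule X.G.series_ring_cring)
  then have h: "inv_into (carrier SR) \<Phi> \<in> ring_iso Y.G SR"
    using ring_iso_set_sym[OF _ \<Phi>_iso] by (simp add: cring.axioms(1))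
  moreover have "gabber_proj s = series_proj (inv_into (carrier SR) \<Phi> s)" if "s \<in> carrier Y.G" for s
    using \<Phi>_proj[OF inv_into_into[OF \<Phi>_surj[OF that]]]
    by (simp only: f_inv_into_f[OF \<Phi>_surj[OF that]])
  ultimately show ?thesis by blast
qed

end
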